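(* Let $T$ be an exceptional Jacobi operator. Then there exist a polynomial $\tau$ with $\tau(1)\neq 0$, $\tau(-1)\neq 0$, real numbers $\alpha,\beta$, a constant $c$ and a gauge factor $\mu$ such that $\mathcal{M}(\mu)\circ T\circ \mathcal{M}(\mu^{-1})+c = T_{\mathrm{ng}}(\tau;\alpha,\beta)$, where $\mathcal{M}(f)$ denotes the multiplication operator $y\mapsto fy$. Moreover, in that case, $T_{\mathrm{ng}}(\tau;\alpha,\beta)$ is itself an exceptional Jacobi operator.
   Context: All differential operators act on functions of $x$; $D=D_x=d/dx$. A second order differential operator $T=pD^2+qD+r$ with rational coefficients $p,q,r$ is called exceptional if there is a finite set $F\subset\mathbb{N}_0$ such that for every $n\in\mathbb{N}_0\setminus F$ there is a nonzero polynomial $P$ of degree $n$ and a constant $\lambda$ with $TP=\lambda P$. It is an exceptional Jacobi operator if moreover $p(x)=x^2-1$. For $\alpha,\beta\in\mathbb{R}$ set $\eta(x;\alpha,\beta)=\frac{\alpha+1}{x-1}+\frac{\beta+1}{x+1}$, and for a polynomial $\tau$ define $$T_{\mathrm{ng}}(\tau;\alpha,\beta)=(x^2-1)\Big(D^2-2\tfrac{\tau'}{\tau}D+\tfrac{\tau''}{\tau}+\eta(x;\alpha,\beta)\big(D-\tfrac{\tau'}{\tau}\big)\Big)+2x\tfrac{\tau'}{\tau}.$$ A gauge transformation of an operator $T$ is an operator of the form $\mathcal{M}(\mu)\circ T\circ\mathcal{M}(\mu^{-1})$ for a nonzero function $\mu$; a spectral shift is the addition of a constant. *)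

theory Defs
  imports "HOL-Analysis.Analysis" "HOL-Computational_Algebra.Polynomial"
begin

text \<open>A real rational function, represented as numerator/denominator pair
  (the denominator is required to be nonzero where relevant).\<close>
type_synonym ratfun = "real poly \<times> real poly"

definition reval :: "ratfun \<Rightarrow> real \<Rightarrow> real" where
  "reval f x = poly (fst f) x / poly (snd f) x"

definition ratfun_ok :: "ratfun \<Rightarrow> bool" where
  "ratfun_ok f \<longleftrightarrow> snd f \<noteq> 0"

text \<open>A second order operator p D^2 + q D + r with rational coefficients.\<close>
type_synonym ratop = "ratfun \<times> ratfun \<times> ratfun"

definition op_ok :: "ratop \<Rightarrow> bool" where
  "op_ok T \<longleftrightarrow> (case T of (p, q, r) \<Rightarrow> ratfun_ok p \<and> ratfun_ok q \<and> ratfun_ok r)"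

definition op_defined_at :: "ratop \<Rightarrow> real \<Rightarrow> bool" where
  "op_defined_at T x \<longleftrightarrow> (case T of (p, q, r) \<Rightarrow>
     poly (snd p) x \<noteq> 0 \<and> poly (snd q) x \<noteq> 0 \<and> poly (snd r) x \<noteq> 0)"

definition op_apply :: "ratop \<Rightarrow> (real \<Rightarrow> real) \<Rightarrow> real \<Rightarrow> real" where
  "op_apply T y x = (case T of (p, q, r) \<Rightarrow>
     reval p x * deriv (deriv y) x + reval q x * deriv y x + reval r x * y x)"

text \<open>Exceptional operator: for all degrees n outside a finite set there is a
  nonzero polynomial eigenfunction of degree n (T P = lambda P as rational functions,
  i.e. at every point where the coefficients are defined).\<close>
definition exceptional :: "ratop \<Rightarrow> bool" where
  "exceptional T \<longleftrightarrow> op_ok T \<and>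
     (\<exists>F :: nat set. finite F \<and> (\<forall>n. n \<notin> F \<longrightarrow>
        (\<exists>(P :: real poly) (lam :: real). P \<noteq> 0 \<and> degree P = n \<and>
           (\<forall>x. op_defined_at T x \<longrightarrow> op_apply T (poly P) x = lam * poly P x))))"

definition exceptional_jacobi :: "ratop \<Rightarrow> bool" where
  "exceptional_jacobi T \<longleftrightarrow> exceptional T \<and>
     (case T of (p, q, r) \<Rightarrow> (\<forall>x. poly (snd p) x \<noteq> 0 \<longrightarrow> reval p x = x\<^sup>2 - 1))"

definition eta :: "real \<Rightarrow> real \<Rightarrow> real \<Rightarrow> real" where
  "eta \<alpha> \<beta> x = (\<alpha> + 1) / (x - 1) + (\<beta> + 1) / (x + 1)"

definition Tng :: "real poly \<Rightarrow> real \<Rightarrow> real \<Rightarrow> (real \<Rightarrow> real) \<Rightarrow> real \<Rightarrow> real" where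
  "Tng \<tau> \<alpha> \<beta> y x =
     (x\<^sup>2 - 1) * (deriv (deriv y) x
        - 2 * (poly (pderiv \<tau>) x / poly \<tau> x) * deriv y x
        + (poly (pderiv (pderiv \<tau>)) x / poly \<tau> x) * y x
        + eta \<alpha> \<beta> x * (deriv y x - (poly (pderiv \<tau>) x / poly \<tau> x) * y x))
     + 2 * x * (poly (pderiv \<tau>) x / poly \<tau> x) * y x"

definition twice_diff_on :: "(real \<Rightarrow> real) \<Rightarrow> real set \<Rightarrow> bool" where
  "twice_diff_on y I \<longleftrightarrow> (\<forall>x\<in>I. y differentiable (at x) \<and> deriv y differentiable (at x))"

end

theory Submission
  imports Defs "HOL-Computational_Algebra.Computational_Algebra"
begin

text \<open>
  After division by the greatest common divisor \<open>M\<close> of the eigenpolynomials, their complex span \<open>U\<close>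
  is a \<open>T\<close>-invariant space of polynomials of finite codimension whose elements have no common zero.
  At a point \<open>\<xi>\<close> the set of orders of elements of \<open>U\<close> is then cofinite and contains \<open>0\<close>. If \<open>T\<close>
  lowers orders at \<open>\<xi>\<close> by \<open>D\<close>, the descent from large orders can only stop, in each residue class
  modulo \<open>D\<close>, at a root of the indicial polynomial. Counting roots shows that \<open>q\<close> and \<open>r\<close> are regular
  at \<open>\<plusminus>1\<close>, and that elsewhere \<open>D = 2\<close> and the exponents are \<open>0\<close> and \<open>2\<nu> + 1\<close>. Hence
  \<open>q / p\<close> has residue \<open>- 2\<nu>\<close>, and the absence of the odd orders below \<open>2\<nu> + 1\<close> determines the
  residue of \<open>r\<close>. With \<open>\<sigma> = \<Prod>(x - \<xi>)\<^sup>\<nu>\<close> and \<open>N = \<Prod>(x - \<xi>)\<close> to the powers \<open>\<nu>(\<nu> - 1) / 2\<close>, conjugation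
  by \<open>N / M\<close> gives an operator with the poles of the natural form for \<open>\<tau> = \<sigma> N\<close>; the difference is a
  polynomial of degree \<open>0\<close> because \<open>T\<close> does not raise degrees. The products of \<open>N / M\<close> with the
  eigenpolynomials are polynomials, so the natural form is again exceptional.
\<close>

unbundle no vec_syntax
unbundle fps_syntax

section \<open>Laurent series operators with an invariant space of power series\<close>

text \<open>\<open>a\<close> may be zero, so \<open>k\<close> only bounds the order from below. This
  keeps the predicate stable under sums whose leading terms cancel. The second coefficient is
  recorded because the residue of \<open>r\<close> is determined at that level.\<close>

definition leading2 :: "int \<Rightarrow> 'a::comm_ring_1 fls \<Rightarrow> 'a \<Rightarrow> 'a \<Rightarrow> bool" where
  "leading2 k f a b \<longleftrightarrow> (\<forall>j<k. f $$ j = 0) \<and> f $$ k = a \<and> f $$ (k + 1) = b"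

lemma leading2_iff_shift:
  "leading2 k f a b \<longleftrightarrow> (\<exists>F. f = fls_shift (-k) (fps_to_fls F) \<and> F $ 0 = a \<and> F $ 1 = b)"
proof
  assume L: "leading2 k f a b"
  define F where "F = Abs_fps (\<lambda>n. f $$ (k + int n))"
  have "f $$ n = fls_shift (-k) (fps_to_fls F) $$ n" for n
    using L by (auto simp: F_def leading2_def)
  hence "f = fls_shift (-k) (fps_to_fls F)"
    by (rule fls_eqI)
  moreover have "F $ 0 = a" "F $ 1 = b"
    using L by (auto simp: F_def leading2_def)
  ultimately show "\<exists>F. f = fls_shift (-k) (fps_to_fls F) \<and> F $ 0 = a \<and> F $ 1 = b"
    by blast
qed (auto simp: leading2_def)

lemma leading2_mult:
  assumes "leading2 k f a b" "leading2 l g c d"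
  shows "leading2 (k + l) (f * g) (a * c) (a * d + b * c)"
proof -
  obtain F G where F: "f = fls_shift (-k) (fps_to_fls F)" "F $ 0 = a" "F $ 1 = b"
    and G: "g = fls_shift (-l) (fps_to_fls G)" "G $ 0 = c" "G $ 1 = d"
    using assms unfolding leading2_iff_shift by blast
  have "f * g = fls_shift (-(k + l)) (fps_to_fls (F * G))"
    by (simp add: F G fls_times_both_shifted_simp fls_times_fps_to_fls add.commute)
  moreover have "(F * G) $ 0 = a * c" "(F * G) $ 1 = a * d + b * c"
    using F G by (simp_all add: fps_mult_nth_1)
  ultimately show ?thesis
    unfolding leading2_iff_shift by blast
qed

lemma leading2_add:
  "leading2 k f a b \<Longrightarrow> leading2 k g c d \<Longrightarrow> leading2 k (f + g) (a + c) (b + d)"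
  by (simp add: leading2_def)

lemma leading2_diff:
  "leading2 k f a b \<Longrightarrow> leading2 k g c d \<Longrightarrow> leading2 k (f - g) (a - c) (b - d)"
  by (simp add: leading2_def)

lemma leading2_deriv:
  "leading2 k f a b \<Longrightarrow> leading2 (k - 1) (fls_deriv f) (of_int k * a) (of_int (k + 1) * b)"
  by (auto simp: leading2_def)

lemma leading2_lower: "leading2 k f a b \<Longrightarrow> leading2 (k - 1) f 0 a"
  by (auto simp: leading2_def)

lemma leading2_cong:
  "leading2 k f a b \<Longrightarrow> k = k' \<Longrightarrow> a = a' \<Longrightarrow> b = b' \<Longrightarrow> leading2 k' f a' b'"
  by simp

text \<open>The starting exponents make all three terms shift orders by exactly \<open>- D\<close>.
  The first coefficient is the indicial polynomial at \<open>k\<close> times \<open>a\<close>; in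
  the second, \<open>b\<close> meets the indicial polynomial at \<open>k + 1\<close> and
  \<open>a\<close> meets its analogue formed from \<open>p1\<close>, \<open>q1\<close>,
  \<open>r1\<close>.\<close>

lemma leading2_operator:
  fixes p q r y :: "'a::comm_ring_1 fls"
  assumes p: "leading2 (2 - D) p p0 p1" and q: "leading2 (1 - D) q q0 q1"
    and r: "leading2 (-D) r r0 r1" and y: "leading2 k y a b"
  shows "leading2 (k - D) (p * fls_deriv (fls_deriv y) + q * fls_deriv y + r * y)
     ((p0 * of_int (k * (k - 1)) + q0 * of_int k + r0) * a)
     ((p0 * of_int ((k + 1) * k) + q0 * of_int (k + 1) + r0) * b
       + (p1 * of_int (k * (k - 1)) + q1 * of_int k + r1) * a)"
proof -
  note y1 = leading2_deriv[OF y]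
  note y2 = leading2_deriv[OF y1]
  have 1: "leading2 (k - D) (p * fls_deriv (fls_deriv y))
      (p0 * (of_int (k - 1) * (of_int k * a)))
      (p0 * (of_int (k - 1 + 1) * (of_int (k + 1) * b)) + p1 * (of_int (k - 1) * (of_int k * a)))"
    by (rule leading2_cong[OF leading2_mult[OF p y2]]) auto
  have 2: "leading2 (k - D) (q * fls_deriv y)
      (q0 * (of_int k * a)) (q0 * (of_int (k + 1) * b) + q1 * (of_int k * a))"
    by (rule leading2_cong[OF leading2_mult[OF q y1]]) auto
  have 3: "leading2 (k - D) (r * y) (r0 * a) (r0 * b + r1 * a)"
    by (rule leading2_cong[OF leading2_mult[OF r y]]) auto
  show ?thesis
    by (rule leading2_cong[OF leading2_add[OF leading2_add[OF 1 2] 3]])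
       (auto simp: algebra_simps)
qed

section \<open>Orders of the elements of an invariant space and their descent\<close>

locale local_operator =
  fixes p q r :: "complex fls" and U :: "complex fls set"
  assumes regular: "u \<in> U \<Longrightarrow> j < 0 \<Longrightarrow> u $$ j = 0"
    and invariant: "u \<in> U \<Longrightarrow> p * fls_deriv (fls_deriv u) + q * fls_deriv u + r * u \<in> U"
    and p_regular: "j < 0 \<Longrightarrow> p $$ j = 0"
    and cofinite_orders: "finite {k. \<not> (\<exists>u\<in>U. u \<noteq> 0 \<and> fls_subdegree u = int k)}"
    and order_zero: "\<exists>u\<in>U. u \<noteq> 0 \<and> fls_subdegree u = 0"
begin

unbundle fps_syntax

definition I :: "nat set" where
  "I = {k. \<exists>u\<in>U. u \<noteq> 0 \<and> fls_subdegree u = int k}"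

abbreviation Top :: "complex fls \<Rightarrow> complex fls" where
  "Top u \<equiv> p * fls_deriv (fls_deriv u) + q * fls_deriv u + r * u"

lemma in_I_iff: "k \<in> I \<longleftrightarrow> (\<exists>u\<in>U. \<exists>a b. a \<noteq> 0 \<and> leading2 (int k) u a b)"
proof
  assume "k \<in> I"
  then obtain u where u: "u \<in> U" "u \<noteq> 0" "fls_subdegree u = int k"
    by (auto simp: I_def)
  have "leading2 (int k) u (u $$ int k) (u $$ (int k + 1))"
    using u by (auto simp: leading2_def)
  moreover have "u $$ int k \<noteq> 0"
    using nth_fls_subdegree_nonzero[OF u(2)] u(3) by simp
  ultimately show "\<exists>u\<in>U. \<exists>a b. a \<noteq> 0 \<and> leading2 (int k) u a b"
    using u(1) by blast
next
  assume "\<exists>u\<in>U. \<exists>a b. a \<noteq> 0 \<and> leading2 (int k) u a b"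
  then obtain u a b where "u \<in> U" "a \<noteq> 0" "leading2 (int k) u a b" by blast
  moreover from this have "fls_subdegree u = int k" "u \<noteq> 0"
    by (auto simp: leading2_def intro!: fls_subdegree_eqI)
  ultimately show "k \<in> I"
    unfolding I_def by auto
qed

lemma zero_in_I: "0 \<in> I"
  using order_zero by (auto simp: I_def)

lemma cofinite_I: "finite (- I)"
  using cofinite_orders by (simp add: I_def Compl_eq)

lemma leading2_U_nonneg: "u \<in> U \<Longrightarrow> leading2 k u a b \<Longrightarrow> a \<noteq> 0 \<Longrightarrow> k \<ge> 0"
  using regular[of u k] by (cases "k < 0") (auto simp: leading2_def)

text \<open>Where the indicial polynomial is nonzero, the image of an element of order
  \<open>k\<close> has order exactly \<open>k - D\<close>. The image lies in \<open>U\<close>, which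
  contains no series with a pole.\<close>

lemma order_descent:
  assumes "leading2 (2 - int D) p p0 p1" "leading2 (1 - int D) q q0 q1" "leading2 (- int D) r r0 r1"
    and k: "k \<in> I" and chi: "p0 * of_nat (k * (k - 1)) + q0 * of_nat k + r0 \<noteq> 0"
  shows "D \<le> k \<and> k - D \<in> I"
proof -
  obtain u a b where u: "u \<in> U" "a \<noteq> 0" "leading2 (int k) u a b"
    using k unfolding in_I_iff by blast
  have chi': "(p0 * of_int (int k * (int k - 1)) + q0 * of_int (int k) + r0) * a \<noteq> 0"
  proof -
    \<comment> \<open>At \<open>k = 0\<close> the truncated subtraction does no harm, because the
      other factor is zero.\<close>
    have "int k * (int k - 1) = int (k * (k - 1))"
      by (cases k) (auto simp: algebra_simps)
    thus ?thesis
      using chi u(2) by (simp only: of_int_of_nat_eq mult_eq_0_iff) simp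
  qed
  note T = leading2_operator[OF assms(1-3) u(3)]
  have "int k - int D \<ge> 0"
    using leading2_U_nonneg[OF invariant[OF u(1)] T chi'] .
  hence "D \<le> k" "int k - int D = int (k - D)" by auto
  moreover have "k - D \<in> I"
    unfolding in_I_iff using invariant[OF u(1)] T chi' calculation(2) by metis
  ultimately show ?thesis by blast
qed

lemma residue_class_meets_I:
  assumes "c < D"
  shows "\<exists>k\<in>I. k mod D = c"
proof (rule ccontr)
  assume "\<not> ?thesis"
  hence "(\<lambda>n. n * D + c) ` UNIV \<subseteq> - I"
    using assms by auto
  moreover have "inj (\<lambda>n. n * D + c)"
    using assms by (auto simp: inj_def)
  ultimately show False
    using cofinite_I by (meson finite_imageD finite_subset infinite_UNIV_nat)
qed

text \<open>The least element of \<open>I\<close> in the class of \<open>c\<close> cannot descend,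
  since subtracting \<open>D\<close> stays in the class.\<close>

lemma indicial_root_in_class:
  assumes "leading2 (2 - int D) p p0 p1" "leading2 (1 - int D) q q0 q1" "leading2 (- int D) r r0 r1"
    and "c < D"
  shows "\<exists>k\<in>I. k mod D = c \<and> p0 * of_nat (k * (k - 1)) + q0 * of_nat k + r0 = 0"
proof -
  define k where "k = (LEAST k. k \<in> I \<and> k mod D = c)"
  have k: "k \<in> I" "k mod D = c"
    using residue_class_meets_I[OF assms(4)] LeastI_ex[of "\<lambda>k. k \<in> I \<and> k mod D = c"]
    unfolding k_def by blast+
  have "p0 * of_nat (k * (k - 1)) + q0 * of_nat k + r0 = 0"
  proof (rule ccontr)
    assume "\<not> ?thesis"
    from order_descent[OF assms(1-3) k(1) this] have "D \<le> k" "k - D \<in> I" by auto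
    moreover have "(k - D) mod D = c"
      using k(2) \<open>D \<le> k\<close> by (simp add: le_mod_geq)
    ultimately have "k \<le> k - D"
      unfolding k_def by (intro Least_le) auto
    with \<open>D \<le> k\<close> \<open>c < D\<close> show False by auto
  qed
  with k show ?thesis by blast
qed

text \<open>A pole so deep that \<open>T\<close> lowers orders by \<open>D\<close> while the indicial polynomial is affine leaves at
  most one residue class modulo \<open>D\<close> in which the descent can stop.\<close>

lemma pole_step:
  assumes "D \<ge> 2" and p: "\<forall>j\<le>2 - int D. p $$ j = 0"
    and qr: "\<forall>j< - int D. q $$ (j + 1) = 0 \<and> r $$ j = 0"
  shows "q $$ (1 - int D) = 0 \<and> r $$ (- int D) = 0"
proof -
  have P: "leading2 (2 - int D) p 0 (p $$ (2 - int D + 1))"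
    using p by (auto simp: leading2_def)
  have "q $$ j = 0" if "j < 1 - int D" for j
    using qr[rule_format, of "j - 1"] that by simp
  hence Q: "leading2 (1 - int D) q (q $$ (1 - int D)) (q $$ (1 - int D + 1))"
    by (auto simp: leading2_def)
  have R: "leading2 (- int D) r (r $$ (- int D)) (r $$ (- int D + 1))"
    using qr by (auto simp: leading2_def)
  \<comment> \<open>The order \<open>0\<close> cannot be lowered, so it is a root of the affine
    indicial polynomial. The root found next in the class of \<open>1\<close> is nonzero, which
    makes the linear coefficient vanish as well.\<close>
  have r0: "r $$ (- int D) = 0"
    using order_descent[OF P Q R zero_in_I] assms(1) by auto
  obtain k where "k mod D = 1" "q $$ (1 - int D) * of_nat k + r $$ (- int D) = 0"
    using indicial_root_in_class[OF P Q R, of 1] assms(1) by auto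
  moreover from this have "k \<noteq> 0" using assms(1) by (cases "k = 0") auto
  ultimately show ?thesis using r0 by simp
qed

text \<open>Downward induction on the depth of the pole, starting from a depth below both
  subdegrees.\<close>

lemma pole_bound:
  assumes "m \<ge> 2" and p: "\<forall>j\<le>2 - int m. p $$ j = 0"
  shows "\<forall>j\<le> - int m. q $$ (j + 1) = 0 \<and> r $$ j = 0"
proof -
  \<comment> \<open>The offsets \<open>2\<close> and \<open>1\<close> put \<open>j + 1\<close> and
    \<open>j\<close> strictly below the subdegrees of \<open>q\<close> and \<open>r\<close> for all
    \<open>j \<le> - int M\<close>.\<close>
  define M where "M = nat (max (int m) (max (2 - fls_subdegree q) (1 - fls_subdegree r)))"
  have "m \<le> M" by (auto simp: M_def)
  thus ?thesis
  proof (induction m rule: inc_induct)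
    case base
    show ?case by (auto simp: M_def intro!: fls_eq0_below_subdegree)
  next
    case (step D)
    have *: "q $$ (1 - int D) = 0 \<and> r $$ (- int D) = 0"
      using step assms by (intro pole_step) auto
    show ?case
    proof (intro allI impI)
      fix j assume "j \<le> - int D"
      hence "j = - int D \<or> j \<le> - int (Suc D)" by linarith
      thus "q $$ (j + 1) = 0 \<and> r $$ j = 0"
        using * step.IH by auto
    qed
  qed
qed

text \<open>As \<open>p\<close> vanishes, \<open>pole_bound\<close> applies from
  \<open>m = 2\<close> and leaves at most a simple pole of \<open>r\<close>. For
  \<open>D = 1\<close> the indicial polynomial has the value \<open>r $$ (-1)\<close> at
  \<open>0\<close>, an order that cannot descend.\<close>

lemma regular_at_zero_of_p:
  assumes "p $$ 0 = 0" "j < 0"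
  shows "q $$ j = 0" "r $$ j = 0"
proof -
  have *: "\<forall>j\<le> - 2. q $$ (j + 1) = 0 \<and> r $$ j = 0"
    using pole_bound[of 2] assms(1) p_regular by (auto simp: le_less)
  have "q $$ (i - 1 + 1) = 0" if "i < 0" for i
    by (rule conjunct1[OF *[rule_format]]) (use that in auto)
  hence q: "q $$ i = 0" if "i < 0" for i
    using that by simp
  thus "q $$ j = 0" using assms(2) by simp
  have r: "r $$ i = 0" if "i < -1" for i
    using * that by auto
  have "p $$ i = 0" if "i < 1" for i
    using that assms(1) p_regular[of i] by (cases "i = 0") auto
  hence 1: "leading2 (2 - int 1) p (p $$ 1) (p $$ 2)"
    by (auto simp: leading2_def)
  have 2: "leading2 (1 - int 1) q (q $$ 0) (q $$ 1)"
    using q by (auto simp: leading2_def)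
  have 3: "leading2 (- int 1) r (r $$ (-1)) (r $$ 0)"
    using r by (auto simp: leading2_def)
  have "r $$ (-1) = 0"
    using order_descent[OF 1 2 3 zero_in_I] by auto
  thus "r $$ j = 0"
    using r[of j] assms(2) by (cases "j = -1") auto
qed

text \<open>The least odd order is \<open>2 * nu + 1\<close>; it turns out to be the nonzero
  exponent wherever \<open>p\<close> does not vanish.\<close>

definition nu :: nat where "nu = (LEAST k. odd k \<and> k \<in> I) div 2"

section \<open>Residues of \<open>q\<close> and \<open>r\<close> at a point where \<open>p\<close>
  does not vanish\<close>

context
  assumes p0: "p $$ 0 \<noteq> 0"
begin

unbundle fps_syntax

text \<open>Here \<open>pole_bound\<close> applies from \<open>m = 3\<close>. The remaining double
  pole of \<open>r\<close> is excluded because for \<open>D = 2\<close> the order \<open>0\<close>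
  must be an indicial root.\<close>

lemma poles_off_zero_of_p:
  "j < -1 \<Longrightarrow> q $$ j = 0" "j < -1 \<Longrightarrow> r $$ j = 0"
proof -
  have *: "\<forall>j\<le> - 3. q $$ (j + 1) = 0 \<and> r $$ j = 0"
    using pole_bound[of 3] p_regular by auto
  have "q $$ (i - 1 + 1) = 0" if "i < -1" for i
    by (rule conjunct1[OF *[rule_format]]) (use that in auto)
  hence q: "q $$ i = 0" if "i < -1" for i
    using that by simp
  thus "j < -1 \<Longrightarrow> q $$ j = 0" by simp
  have r: "r $$ i = 0" if "i < -2" for i
    using * that by auto
  have 1: "leading2 (2 - int 2) p (p $$ 0) (p $$ 1)"
    using p_regular by (auto simp: leading2_def)
  have 2: "leading2 (1 - int 2) q (q $$ (-1)) (q $$ 0)"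
    using q by (auto simp: leading2_def)
  have 3: "leading2 (- int 2) r (r $$ (-2)) (r $$ (-1))"
    using r by (auto simp: leading2_def)
  have "r $$ (-2) = 0"
    using order_descent[OF 1 2 3 zero_in_I] by auto
  thus "j < -1 \<Longrightarrow> r $$ j = 0"
    using r[of j] by (cases "j = -2") auto
qed

lemma leading2_coefficients:
  "leading2 (2 - int 2) p (p $$ 0) (p $$ 1)" "leading2 (1 - int 2) q (q $$ (-1)) (q $$ 0)"
  "leading2 (- int 2) r 0 (r $$ (-1))"
  using p_regular poles_off_zero_of_p by (auto simp: leading2_def)

lemma nu_in_I: "2 * nu + 1 \<in> I" and nu_le: "odd k \<Longrightarrow> k \<in> I \<Longrightarrow> 2 * nu + 1 \<le> k"
proof -
  define m where "m = (LEAST k. odd k \<and> k \<in> I)"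
  have "\<exists>k. odd k \<and> k \<in> I"
    using residue_class_meets_I[of 1 2] by (auto simp: odd_iff_mod_2_eq_one)
  hence m: "odd m" "m \<in> I"
    using LeastI_ex[of "\<lambda>k. odd k \<and> k \<in> I"] unfolding m_def by blast+
  hence "m = 2 * nu + 1"
    by (simp add: nu_def m_def)
  thus "2 * nu + 1 \<in> I" using m by simp
  show "2 * nu + 1 \<le> k" if "odd k" "k \<in> I"
    unfolding \<open>m = 2 * nu + 1\<close>[symmetric] m_def using that by (intro Least_le) auto
qed

text \<open>The least odd order cannot descend by \<open>2\<close>, so it is a root of the indicial
  polynomial, from which its nonzero factor \<open>2 * nu + 1\<close> is cancelled.\<close>

lemma residue_q: "q $$ (-1) = - (2 * of_nat nu * p $$ 0)"
proof -
  have "p $$ 0 * of_nat ((2 * nu + 1) * (2 * nu + 1 - 1)) + q $$ (-1) * of_nat (2 * nu + 1) + 0 = 0"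
  proof (rule ccontr)
    assume "\<not> ?thesis"
    from order_descent[OF leading2_coefficients nu_in_I this]
    have "2 \<le> 2 * nu + 1" "2 * nu + 1 - 2 \<in> I" by auto
    moreover have "odd (2 * nu + 1 - 2)" using calculation(1) by auto
    ultimately show False
      using nu_le[of "2 * nu + 1 - 2"] by simp
  qed
  hence "of_nat (2 * nu + 1) * (p $$ 0 * of_nat (2 * nu) + q $$ (-1)) = 0"
    by (simp add: algebra_simps)
  hence "p $$ 0 * of_nat (2 * nu) + q $$ (-1) = 0"
    by (metis mult_eq_0_iff of_nat_eq_0_iff add_is_0 one_neq_zero)
  thus ?thesis by (simp add: add_eq_0_iff algebra_simps)
qed

text \<open>Descent from a large even order never stops before \<open>0\<close>: at a positive even
  \<open>k\<close> the indicial polynomial is \<open>p $$ 0 * k\<close> times the odd integer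
  \<open>k - 1 - 2 * nu\<close>.\<close>

lemma even_in_I: "2 * j \<in> I"
proof -
  have "\<exists>K. j \<le> K \<and> 2 * K \<in> I"
  proof (rule ccontr)
    assume "\<not> ?thesis"
    hence "(\<lambda>n. 2 * n) ` {j..} \<subseteq> - I" by auto
    moreover have "inj_on (\<lambda>n::nat. 2 * n) {j..}" by (auto simp: inj_on_def)
    ultimately show False
      using cofinite_I by (meson finite_imageD finite_subset infinite_Ici)
  qed
  then obtain K where K: "j \<le> K" "2 * K \<in> I" by blast
  from K(1) show ?thesis
  proof (induction j rule: inc_induct)
    case base
    show ?case by (fact K(2))
  next
    case (step i)
    have "complex_of_int (2 * int i + 1 - 2 * int nu) \<noteq> 0"
      by (subst of_int_eq_0_iff) presburger
    moreover have "p $$ 0 * of_nat (2 * Suc i * (2 * Suc i - 1)) + q $$ (-1) * of_nat (2 * Suc i) + 0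
        = p $$ 0 * of_nat (2 * Suc i) * complex_of_int (2 * int i + 1 - 2 * int nu)"
      by (simp add: residue_q algebra_simps)
    ultimately have "p $$ 0 * of_nat (2 * Suc i * (2 * Suc i - 1)) + q $$ (-1) * of_nat (2 * Suc i) + 0 \<noteq> 0"
      using p0 by (simp del: of_nat_Suc)
    from order_descent[OF leading2_coefficients step.IH this] show ?case by simp
  qed
qed

text \<open>Applying \<open>T\<close> repeatedly to an element of order \<open>2 * nu\<close> produces elements of orders
  \<open>2 * nu - 2, \<dots>, 2, 0\<close>. The quotients of their two leading coefficients satisfy a recurrence in
  which the residue of \<open>r\<close> is overdetermined by one equation; \<open>s0 + s1 * j\<close> is its solution.\<close>

lemma residue_r: "r $$ (-1) = of_nat nu * ((1 - 3 * of_nat nu) / 2 * p $$ 1 - q $$ 0)"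
proof -
  define n where "n = nu"
  \<comment> \<open>\<open>c\<close> is the indicial polynomial with its roots \<open>0\<close> and
    \<open>2 * n + 1\<close> made explicit; \<open>d\<close> is the contribution of the next
    coefficients.\<close>
  define c where "c k = p $$ 0 * of_int (k * (k - 1 - 2 * int n))" for k
  define d where "d k = p $$ 1 * of_int (k * (k - 1)) + q $$ 0 * of_int k + r $$ (-1)" for k
  have T: "leading2 (k - 2) (Top u) (c k * a) (c (k + 1) * b + d k * a)"
    if "leading2 k u a b" for k u a b
    by (rule leading2_cong[OF leading2_operator[where D = 2, OF _ _ _ that]])
       (use leading2_coefficients in \<open>auto simp: c_def d_def residue_q n_def algebra_simps\<close>)
  obtain y a b where y: "y \<in> U" "a \<noteq> 0" "leading2 (int (2 * n)) y a b"
    using even_in_I[of n] unfolding in_I_iff by blast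
  define u where "u j = (Top ^^ (n - j)) y" for j
  define A where "A j = u j $$ (2 * int j)" for j
  define B where "B j = u j $$ (2 * int j + 1)" for j
  have u_Suc: "u j = Top (u (Suc j))" if "j < n" for j
  proof -
    have "n - j = Suc (n - Suc j)" using that by simp
    thus ?thesis by (simp add: u_def)
  qed
  have inv: "u j \<in> U \<and> A j \<noteq> 0 \<and> leading2 (2 * int j) (u j) (A j) (B j)" if "j \<le> n" for j
    using that
  proof (induction j rule: inc_induct)
    case base
    show ?case using y by (auto simp: u_def A_def B_def leading2_def)
  next
    case (step j)
    have "leading2 (2 * int (Suc j) - 2) (u j)
       (c (2 * int (Suc j)) * A (Suc j)) (c (2 * int (Suc j) + 1) * B (Suc j) + d (2 * int (Suc j)) * A (Suc j))"
      unfolding u_Suc[OF step.hyps(2)] by (rule T) (use step.IH in blast)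
    hence L: "leading2 (2 * int j) (u j)
       (c (2 * int (Suc j)) * A (Suc j)) (c (2 * int (Suc j) + 1) * B (Suc j) + d (2 * int (Suc j)) * A (Suc j))"
      by simp
    hence A: "A j = c (2 * int (Suc j)) * A (Suc j)"
      by (simp add: leading2_def A_def)
    have "2 * int (Suc j) - 1 - 2 * int n \<noteq> 0" by presburger
    hence "(2 * int (Suc j)) * (2 * int (Suc j) - 1 - 2 * int n) \<noteq> 0" by simp
    hence "c (2 * int (Suc j)) \<noteq> 0"
      using p0 unfolding c_def by (metis mult_eq_0_iff of_int_eq_0_iff)
    hence "A j \<noteq> 0" using A step.IH by simp
    moreover have "leading2 (2 * int j) (u j) (A j) (B j)"
      using L by (auto simp: leading2_def A_def B_def)
    moreover have "u j \<in> U"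
      unfolding u_Suc[OF step.hyps(2)] using step.IH by (intro invariant) blast
    ultimately show ?case by blast
  qed
  define \<beta> where "\<beta> j = B j / A j" for j
  have recurrence: "c (2 * int j + 2) * \<beta> j = c (2 * int j + 3) * \<beta> (Suc j) + d (2 * int j + 2)" if "j < n" for j
  proof -
    have 1: "leading2 (2 * int (Suc j)) (u (Suc j)) (A (Suc j)) (B (Suc j))" "A (Suc j) \<noteq> 0" "A j \<noteq> 0"
      using inv[of "Suc j"] inv[of j] that by auto
    note T[OF 1(1), folded u_Suc[OF that]]
    hence A: "A j = c (2 * int j + 2) * A (Suc j)"
      and B: "B j = c (2 * int j + 3) * B (Suc j) + d (2 * int j + 2) * A (Suc j)"
      by (simp_all add: leading2_def A_def B_def add.commute)
    have "c (2 * int j + 2) \<noteq> 0" using A 1 by auto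
    thus ?thesis
      using 1 unfolding \<beta>_def A B by (simp add: field_simps)
  qed
  \<comment> \<open>One further application of \<open>T\<close>, to the element of order
    \<open>0\<close>: the coefficient at exponent \<open>-1\<close> has to vanish because the image
    is a power series. This is the extra equation.\<close>
  have final: "c 1 * \<beta> 0 + d 0 = 0"
  proof -
    have 1: "u 0 \<in> U" "A 0 \<noteq> 0" "leading2 0 (u 0) (A 0) (B 0)"
      using inv[of 0] by auto
    have "Top (u 0) $$ (-1) = c 1 * B 0 + d 0 * A 0"
      using T[OF 1(3)] by (simp add: leading2_def)
    moreover have "Top (u 0) $$ (-1) = 0"
      using regular[OF invariant[OF 1(1)]] by simp
    ultimately show ?thesis
      using 1 unfolding \<beta>_def by (simp add: field_simps)
  qed
  define \<pi>0 where "\<pi>0 = p $$ 1 / p $$ 0"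
  define \<kappa> where "\<kappa> = q $$ 0 / p $$ 0"
  \<comment> \<open>With \<open>s0\<close> and \<open>s1\<close> all inhomogeneous terms cancel
    except \<open>\<rho>\<close>, the error in the asserted residue of \<open>r\<close> relative to
    \<open>p $$ 0\<close>. Correspondingly \<open>\<gamma>\<close> is the error in
    \<open>\<beta>\<close>.\<close>
  define s0 where "s0 = ((1 - 3 * of_nat n) * \<pi>0 - 2 * \<kappa>) / 4"
  define s1 where "s1 = - \<pi>0 / 2"
  define \<rho> where "\<rho> = r $$ (-1) / p $$ 0 - 2 * of_nat n * s0"
  define \<gamma> where "\<gamma> j = \<beta> j - (s0 + s1 * of_nat j)" for j
  have p1: "p $$ 1 = \<pi>0 * p $$ 0" and q0: "q $$ 0 = \<kappa> * p $$ 0"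
    and r1: "r $$ (-1) = (\<rho> + 2 * of_nat n * s0) * p $$ 0"
    using p0 by (simp_all add: \<pi>0_def \<kappa>_def \<rho>_def)
  have \<beta>: "\<beta> j = \<gamma> j + (s0 + s1 * of_nat j)" for j
    by (simp add: \<gamma>_def)
  have d': "d k = p $$ 0 * (\<pi>0 * of_int (k * (k - 1)) + \<kappa> * of_int k + \<rho> + 2 * of_nat n * s0)" for k
    by (simp add: d_def p1 q0 r1 algebra_simps)
  have rec': "of_int ((2 * int j + 2) * (2 * int j + 1 - 2 * int n)) * \<gamma> j
     = of_int ((2 * int j + 3) * (2 * int j + 2 - 2 * int n)) * \<gamma> (Suc j) + \<rho>" if "j < n" for j
  proof -
    have "p $$ 0 * (of_int ((2 * int j + 2) * (2 * int j + 1 - 2 * int n)) * \<beta> j)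
     = p $$ 0 * (of_int ((2 * int j + 3) * (2 * int j + 2 - 2 * int n)) * \<beta> (Suc j)
        + (\<pi>0 * of_int ((2 * int j + 2) * (2 * int j + 2 - 1)) + \<kappa> * of_int (2 * int j + 2) + \<rho> + 2 * of_nat n * s0))"
      using recurrence[OF that] unfolding c_def d' by (simp add: algebra_simps)
    hence "of_int ((2 * int j + 2) * (2 * int j + 1 - 2 * int n)) * \<beta> j
     = of_int ((2 * int j + 3) * (2 * int j + 2 - 2 * int n)) * \<beta> (Suc j)
        + (\<pi>0 * of_int ((2 * int j + 2) * (2 * int j + 2 - 1)) + \<kappa> * of_int (2 * int j + 2) + \<rho> + 2 * of_nat n * s0)"
      by (rule mult_left_cancel[OF p0, THEN iffD1])
    moreover have "\<pi>0 = - 2 * s1" "\<kappa> = - (1 - 3 * of_nat n) * s1 - 2 * s0"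
      by (simp_all add: s0_def s1_def field_simps)
    ultimately show ?thesis
      unfolding \<beta> by (simp add: algebra_simps)
  qed
  have fin': "\<rho> = 2 * of_nat n * \<gamma> 0"
  proof -
    have "p $$ 0 * (\<rho> - 2 * of_nat n * \<gamma> 0) = 0"
      using final unfolding c_def d' \<beta> by (simp add: algebra_simps)
    thus ?thesis using p0 by simp
  qed
  \<comment> \<open>Contradiction by signs. Below the last index both coefficients of the recurrence
    are negative, so every \<open>\<gamma> j\<close> is a positive multiple of
    \<open>\<gamma> 0\<close>. At \<open>j = n - 1\<close> the coefficient of
    \<open>\<gamma> n\<close> vanishes, which forces
    \<open>\<gamma> (n - 1) = - \<gamma> 0\<close>.\<close>
  have "\<rho> = 0"
  proof (rule ccontr)
    assume "\<rho> \<noteq> 0"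
    hence n: "n > 0" and \<gamma>0: "\<gamma> 0 \<noteq> 0" using fin' by auto
    have "\<exists>t>0. \<gamma> j = of_real t * \<gamma> 0" if "j < n" for j
      using that
    proof (induction j)
      case 0
      show ?case by (rule exI[of _ 1]) auto
    next
      case (Suc j)
      then obtain t where t: "t > 0" "\<gamma> j = of_real t * \<gamma> 0" by auto
      define e1 where "e1 = (2 * real j + 2) * (2 * real j + 1 - 2 * real n)"
      define e2 where "e2 = (2 * real j + 3) * (2 * real j + 2 - 2 * real n)"
      have jn: "real j + 1 < real n" using Suc.prems by linarith
      have "e1 < 0" "e2 < 0"
        unfolding e1_def e2_def using jn by (intro mult_pos_neg; simp)+
      define t' where "t' = (e1 * t - 2 * real n) / e2"
      have "e1 * t < 0" using \<open>e1 < 0\<close> t(1) by (simp add: mult_neg_pos)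
      hence "t' > 0"
        unfolding t'_def using \<open>e2 < 0\<close> by (intro divide_neg_neg) auto
      have "of_real e1 * \<gamma> j = of_real e2 * \<gamma> (Suc j) + 2 * of_nat n * \<gamma> 0"
        using rec'[of j] Suc.prems fin' by (simp add: e1_def e2_def)
      hence "of_real e2 * \<gamma> (Suc j) = of_real (e1 * t - 2 * real n) * \<gamma> 0"
        using t(2) by (simp add: algebra_simps)
      hence "\<gamma> (Suc j) = of_real t' * \<gamma> 0"
        using \<open>e2 < 0\<close> by (simp add: t'_def field_simps)
      with \<open>t' > 0\<close> show ?case by blast
    qed
    moreover obtain m where m: "n = Suc m"
      using n gr0_conv_Suc by blast
    ultimately obtain t where t: "t > 0" "\<gamma> m = of_real t * \<gamma> 0" by auto
    have 1: "(2 * int m + 2) * (2 * int m + 1 - 2 * int n) = - int (2 * n)"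
      and 2: "(2 * int m + 3) * (2 * int m + 2 - 2 * int n) = 0"
      by (simp_all add: m)
    have "- of_nat (2 * n) * \<gamma> m = 2 * of_nat n * \<gamma> 0"
      using rec'[of m, unfolded 1 2 fin'] m by simp
    moreover have "of_real (2 * real n * (1 + t)) * \<gamma> 0 = 2 * of_nat n * \<gamma> 0 - (- of_nat (2 * n) * \<gamma> m)"
      unfolding t(2) by (simp add: algebra_simps)
    ultimately have "of_real (2 * real n * (1 + t)) * \<gamma> 0 = 0"
      by (simp only: diff_self)
    moreover have "2 * real n * (1 + t) \<noteq> 0" using n t(1) by simp
    ultimately show False using \<gamma>0 by (metis mult_eq_0_iff of_real_eq_0_iff)
  qed
  hence "r $$ (-1) = of_nat n * (2 * s0) * p $$ 0"
    using r1 by simp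
  also have "2 * s0 = (1 - 3 * of_nat n) / 2 * \<pi>0 - \<kappa>"
    by (simp add: s0_def diff_divide_distrib)
  finally show ?thesis
    unfolding p1 q0 n_def[symmetric] by (simp only: left_diff_distrib mult.assoc)
qed

end
end

section \<open>Complex zeros of real polynomials\<close>

definition cpoly :: "real poly \<Rightarrow> complex poly" where
  "cpoly = map_poly of_real"

lemma coeff_cpoly [simp]: "coeff (cpoly f) n = of_real (coeff f n)"
  by (simp add: cpoly_def coeff_map_poly)

lemma cpoly_add: "cpoly (f + g) = cpoly f + cpoly g"
  and cpoly_diff: "cpoly (f - g) = cpoly f - cpoly g"
  and cpoly_smult: "cpoly (smult a f) = smult (of_real a) (cpoly f)"
  and cpoly_pderiv: "cpoly (pderiv f) = pderiv (cpoly f)"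
  and cpoly_mult: "cpoly (f * g) = cpoly f * cpoly g"
  by (auto intro!: poly_eqI simp: coeff_pderiv coeff_mult)

lemma cpoly_inject: "cpoly f = cpoly g \<longleftrightarrow> f = g"
  by (auto simp: poly_eq_iff)

lemma cpoly_0 [simp]: "cpoly 0 = 0"
  by (simp add: cpoly_def)

lemma cpoly_pCons [simp]: "cpoly (pCons a f) = pCons (of_real a) (cpoly f)"
  by (simp add: cpoly_def map_poly_pCons)

lemma cpoly_eq_0_iff [simp]: "cpoly f = 0 \<longleftrightarrow> f = 0"
  using cpoly_inject[of f 0] by simp

lemma degree_cpoly [simp]: "degree (cpoly f) = degree f"
  unfolding cpoly_def by (rule degree_map_poly) auto

lemma poly_cpoly_of_real [simp]: "poly (cpoly f) (of_real x) = of_real (poly f x)"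
  by (induction f) (auto simp: cpoly_def map_poly_pCons)

text \<open>As \<open>cpoly d\<close> has real coefficients, the real part of a complex cofactor is
  a real cofactor.\<close>

lemma cpoly_dvd_imp_dvd:
  assumes "cpoly d dvd cpoly f"
  shows "d dvd f"
proof -
  from assms obtain g where g: "cpoly f = cpoly d * g" by (elim dvdE)
  have "f = d * map_poly Re g"
    using g by (auto simp: poly_eq_iff coeff_mult coeff_map_poly complex_eq_iff)
  thus ?thesis by simp
qed

section \<open>Conjugation, and real polynomials with prescribed complex zeros\<close>

lemma cnj_invariant_imp_real:
  assumes "map_poly cnj h = h"
  obtains f where "h = cpoly f"
proof
  have "cnj (coeff h n) = coeff h n" for n
    using assms by (metis coeff_map_poly complex_cnj_zero)
  thus "h = cpoly (map_poly Re h)"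
    by (intro poly_eqI) (simp add: coeff_map_poly complex_eq_iff complex_cnj_cancel_iff)
qed

lemma map_poly_cnj_mult: "map_poly cnj (f * g) = map_poly cnj f * map_poly cnj g"
  by (rule poly_eqI) (simp add: coeff_map_poly coeff_mult)

lemma map_poly_cnj_cpoly [simp]: "map_poly cnj (cpoly f) = cpoly f"
  by (rule poly_eqI) (simp add: coeff_map_poly)

lemma map_poly_cnj_add: "map_poly cnj (f + g) = map_poly cnj f + map_poly cnj g"
  and map_poly_cnj_smult: "map_poly cnj (smult a f) = smult (cnj a) (map_poly cnj f)"
  by (auto intro!: poly_eqI simp: coeff_map_poly)

lemma map_poly_cnj_cnj [simp]: "map_poly cnj (map_poly cnj f) = f"
  by (rule poly_eqI) (simp add: coeff_map_poly)

lemma map_poly_cnj_eq_0_iff [simp]: "map_poly cnj f = 0 \<longleftrightarrow> f = 0"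
  by (auto simp: poly_eq_iff coeff_map_poly)

lemma order_map_poly_cnj: "order (cnj \<xi>) (map_poly cnj f) = order \<xi> f"
proof (cases "f = 0")
  case False
  have *: "order \<xi> f \<le> order (cnj \<xi>) (map_poly cnj f)" if "f \<noteq> 0" for f \<xi>
  proof -
    have lin: "map_poly cnj ([:- \<xi>, 1:] ^ n) = [:- cnj \<xi>, 1:] ^ n" for n
    proof (induction n)
      case (Suc n)
      thus ?case by (simp only: power_Suc map_poly_cnj_mult) (simp add: map_poly_pCons)
    qed (simp add: map_poly_1')
    obtain g where "f = [:- \<xi>, 1:] ^ order \<xi> f * g"
      using order_1 by (metis dvdE)
    hence "map_poly cnj f = [:- cnj \<xi>, 1:] ^ order \<xi> f * map_poly cnj g"
      by (metis lin map_poly_cnj_mult)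
    hence "[:- cnj \<xi>, 1:] ^ order \<xi> f dvd map_poly cnj f" by simp
    thus ?thesis using that by (simp add: order_divides)
  qed
  show ?thesis
    using *[OF False, of \<xi>] *[of "map_poly cnj f" "cnj \<xi>"] False by simp
qed (simp add: order_def)

lemma order_prod_linear:
  assumes "finite Z"
  shows "order \<xi> (\<Prod>z\<in>Z. [:- z, 1:] ^ f z) = (if \<xi> \<in> Z then f \<xi> else 0)"
  using assms
proof (induction Z rule: finite_induct)
  case (insert z Z)
  have "order \<xi> ([:- z, 1:] ^ f z) = (if \<xi> = z then f z else 0)"
    by (auto simp: order_power_n_n intro!: order_0I)
  moreover have "[:- z, 1:] ^ f z * (\<Prod>z\<in>Z. [:- z, 1:] ^ f z) \<noteq> 0"
    using insert.hyps by simp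
  ultimately show ?case
    using insert by (auto simp: order_mult)
qed simp

text \<open>The product of linear factors over the prescribed zeros is invariant under conjugation,
  because \<open>f\<close> is, and hence has real coefficients.\<close>

lemma real_poly_with_orders:
  fixes f :: "complex \<Rightarrow> nat"
  assumes "finite {\<xi>. f \<xi> \<noteq> 0}" and cnj: "\<And>\<xi>. f (cnj \<xi>) = f \<xi>"
  obtains h where "h \<noteq> 0" "\<And>\<xi>. order \<xi> (cpoly h) = f \<xi>"
proof -
  define Z where "Z = {\<xi>. f \<xi> \<noteq> 0}"
  define H where "H = (\<Prod>z\<in>Z. [:- z, 1:] ^ f z)"
  have "finite Z" using assms by (simp add: Z_def)
  have "H \<noteq> 0" using \<open>finite Z\<close> by (simp add: H_def)
  have "poly (map_poly cnj H) x = poly H x" for x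
  proof -
    have "poly (map_poly cnj H) x = (\<Prod>z\<in>Z. (x - cnj z) ^ f z)"
      by (simp add: H_def poly_prod)
    also have "\<dots> = (\<Prod>z\<in>Z. (x - z) ^ f z)"
      by (rule prod.reindex_bij_witness[of _ cnj cnj]) (auto simp: cnj Z_def)
    also have "\<dots> = poly H x"
      by (simp add: H_def poly_prod)
    finally show ?thesis .
  qed
  hence "map_poly cnj H = H"
    by (simp add: poly_eq_poly_eq_iff[symmetric] fun_eq_iff)
  then obtain h where h: "H = cpoly h"
    by (rule cnj_invariant_imp_real)
  show ?thesis
  proof (rule that)
    show "h \<noteq> 0" using \<open>H \<noteq> 0\<close> h by auto
    show "order \<xi> (cpoly h) = f \<xi>" for \<xi>
      unfolding h[symmetric] H_def order_prod_linear[OF \<open>finite Z\<close>] by (simp add: Z_def)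
  qed
qed

text \<open>The Taylor expansion in powers of \<open>x - \<xi>\<close>, placed among the Laurent
  series so that quotients with poles can be formed.\<close>

definition expansion :: "complex \<Rightarrow> complex poly \<Rightarrow> complex fls" where
  "expansion \<xi> f = fps_to_fls (fps_of_poly (pcompose f [:\<xi>, 1:]))"

lemma expansion_add: "expansion \<xi> (f + g) = expansion \<xi> f + expansion \<xi> g"
  and expansion_diff: "expansion \<xi> (f - g) = expansion \<xi> f - expansion \<xi> g"
  and expansion_mult: "expansion \<xi> (f * g) = expansion \<xi> f * expansion \<xi> g"
  and expansion_pderiv: "expansion \<xi> (pderiv f) = fls_deriv (expansion \<xi> f)"
  and expansion_1 [simp]: "expansion \<xi> 1 = 1"
  and expansion_0 [simp]: "expansion \<xi> 0 = 0"
  by (simp_all add: expansion_def pcompose_add pcompose_diff pcompose_mult fps_of_poly_simps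
      fls_times_fps_to_fls fls_deriv_fps_to_fls fps_of_poly_pderiv[symmetric] pderiv_pcompose
      pderiv_pCons pcompose_1 fps_of_poly_diff fps_of_poly_mult fps_of_poly_add)

lemma expansion_eq_0_iff [simp]: "expansion \<xi> f = 0 \<longleftrightarrow> f = 0"
proof
  assume "expansion \<xi> f = 0"
  hence "pcompose f [:\<xi>, 1:] = 0"
    using fps_of_poly_eq_iff[of "pcompose f [:\<xi>, 1:]" 0] by (simp add: expansion_def)
  thus "f = 0"
    by (rule pcompose_eq_0) auto
qed simp

lemma expansion_nth_neg [simp]: "j < 0 \<Longrightarrow> expansion \<xi> f $$ j = 0"
  by (simp add: expansion_def)

lemma expansion_nth_0: "expansion \<xi> f $$ 0 = poly f \<xi>"
  by (simp add: expansion_def coeff_pcompose_0)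

lemma subdegree_expansion:
  assumes "f \<noteq> 0"
  shows "fls_subdegree (expansion \<xi> f) = int (order \<xi> f)"
proof -
  obtain g where g: "f = [:- \<xi>, 1:] ^ order \<xi> f * g" "\<not> [:- \<xi>, 1:] dvd g"
    using order_decomp[OF assms] by blast
  have "expansion \<xi> ([:- \<xi>, 1:] ^ n) = fls_X ^ n" for n
  proof (induction n)
    case (Suc n)
    have "expansion \<xi> [:- \<xi>, 1:] = fls_X"
      by (simp add: expansion_def pcompose_pCons fps_of_poly_pCons)
    with Suc show ?case by (simp only: power_Suc expansion_mult)
  qed simp
  hence "expansion \<xi> f = fls_X ^ order \<xi> f * expansion \<xi> g"
    using g(1) by (metis expansion_mult)
  moreover have "expansion \<xi> g $$ 0 \<noteq> 0"
    using g(2) by (simp add: expansion_nth_0 poly_eq_0_iff_dvd)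
  hence "fls_subdegree (expansion \<xi> g) = 0" "expansion \<xi> g \<noteq> 0"
    by (auto intro!: fls_subdegree_eqI)
  ultimately show ?thesis
    by simp
qed

text \<open>A nonconstant \<open>d\<close> has a root, which the orders make a root of
  \<open>f\<close> too; cancelling this linear factor from both lowers the degree of
  \<open>d\<close>.\<close>

lemma complex_dvd_by_orders:
  fixes d f :: "complex poly"
  assumes "f \<noteq> 0" "d \<noteq> 0" "\<And>\<xi>. order \<xi> d \<le> order \<xi> f"
  shows "d dvd f"
  using assms
proof (induction "degree d" arbitrary: d f)
  case 0
  thus ?case using is_unit_iff_degree[of d] by (auto intro: unit_imp_dvd)
next
  case (Suc n)
  have "\<not> constant (poly d)"
    using Suc.hyps(2) by (simp add: constant_degree)
  then obtain z where z: "poly d z = 0"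
    using fundamental_theorem_of_algebra by blast
  hence "order z d \<noteq> 0" using Suc.prems(2) by (simp add: order_root)
  hence "poly f z = 0" using Suc.prems(3)[of z] by (simp add: order_root)
  with z obtain d' f' where d': "d = [:- z, 1:] * d'" and f': "f = [:- z, 1:] * f'"
    by (auto simp: poly_eq_0_iff_dvd elim!: dvdE)
  have nz: "d' \<noteq> 0" "f' \<noteq> 0" using Suc.prems d' f' by auto
  have "degree d = Suc (degree d')"
    using nz unfolding d' by (subst degree_mult_eq) auto
  moreover have "order \<xi> d' \<le> order \<xi> f'" for \<xi>
    using Suc.prems(3)[of \<xi>] order_mult[of "[:- z, 1:]" d' \<xi>] order_mult[of "[:- z, 1:]" f' \<xi>] Suc.prems(1,2)
    unfolding d' f' by simp
  ultimately have "d' dvd f'"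
    using Suc.hyps(1)[of d' f'] Suc.hyps(2) nz by auto
  thus ?case unfolding d' f' by (rule mult_dvd_mono[OF dvd_refl])
qed

text \<open>The passage from local to global: a quotient without a pole at any complex point is a
  polynomial. The pole computations in \<open>natural_form\<close> are turned into divisibility this
  way.\<close>

lemma dvd_by_expansions:
  assumes "d \<noteq> 0" "\<And>\<xi> j. j < 0 \<Longrightarrow> (expansion \<xi> (cpoly f) / expansion \<xi> (cpoly d)) $$ j = 0"
  shows "d dvd f"
proof (cases "f = 0")
  case False
  have "order \<xi> (cpoly d) \<le> order \<xi> (cpoly f)" for \<xi>
  proof -
    have nz: "expansion \<xi> (cpoly f) \<noteq> 0" "expansion \<xi> (cpoly d) \<noteq> 0"
      using False assms(1) by auto
    hence "fls_subdegree (expansion \<xi> (cpoly f) / expansion \<xi> (cpoly d)) \<ge> 0"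
      using assms(2) by (intro fls_subdegree_geI) auto
    thus ?thesis
      using nz False assms(1) by (simp add: fls_divide_subdegree subdegree_expansion)
  qed
  hence "cpoly d dvd cpoly f"
    using False assms(1) by (intro complex_dvd_by_orders) auto
  thus ?thesis by (rule cpoly_dvd_imp_dvd)
qed simp

text \<open>The pole is at most simple by comparing subdegrees in
  \<open>g * f = fls_deriv f\<close>; comparing leading coefficients there gives the
  residue.\<close>

lemma leading2_log_deriv:
  fixes f :: "complex fls"
  assumes "f \<noteq> 0"
  defines "g \<equiv> fls_deriv f / f"
  shows "leading2 (-1) g (of_int (fls_subdegree f)) (g $$ 0)"
proof -
  define n where "n = fls_subdegree f"
  have gf: "g * f = fls_deriv f" unfolding g_def using assms(1) by simp
  have f: "leading2 n f (f $$ n) (f $$ (n + 1))"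
    by (auto simp: leading2_def n_def)
  have "n - 1 \<le> fls_subdegree g + n" if "g \<noteq> 0"
  proof -
    have "fls_deriv f \<noteq> 0" using that by (auto simp: g_def)
    hence "n - 1 \<le> fls_subdegree (fls_deriv f)"
      using leading2_deriv[OF f] by (intro fls_subdegree_geI) (auto simp: leading2_def)
    thus ?thesis
      unfolding gf[symmetric] using that assms(1) by (simp add: n_def)
  qed
  hence "g $$ j = 0" if "j < -1" for j
    using that by (cases "g = 0") auto
  hence g: "leading2 (-1) g (g $$ (-1)) (g $$ 0)"
    by (auto simp: leading2_def)
  have "g $$ (-1) * f $$ n = of_int n * f $$ n"
    using leading2_mult[OF g f, unfolded gf] leading2_deriv[OF f]
    by (simp add: leading2_def del: fls_deriv_nth)
  moreover have "f $$ n \<noteq> 0" using assms by (simp add: n_def)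
  ultimately have "g $$ (-1) = of_int n" by simp
  thus ?thesis using g by (simp add: n_def)
qed

section \<open>Degree bounds and the invariant span of the eigenpolynomials\<close>

text \<open>Induction on \<open>F\<close>: adjoining the monomial of degree \<open>j\<close> to
  \<open>U\<close> removes \<open>j\<close> from the exceptional degrees, and the enlarged space
  \<open>V\<close> gains at most one order.\<close>

lemma finite_missing_orders:
  fixes U :: "complex poly set"
  assumes "finite F" "0 \<in> U" "\<And>u v. u \<in> U \<Longrightarrow> v \<in> U \<Longrightarrow> u + v \<in> U"
    "\<And>u a. u \<in> U \<Longrightarrow> smult a u \<in> U" "\<And>f. \<exists>u\<in>U. \<forall>j. coeff (f - u) j \<noteq> 0 \<longrightarrow> j \<in> F"
  shows "finite {k. \<not> (\<exists>u\<in>U. u \<noteq> 0 \<and> order \<xi> u = k)}"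
  using assms
proof (induction F arbitrary: U rule: finite_induct)
  case empty
  have "f \<in> U" for f
  proof -
    obtain u where "u \<in> U" "f - u = 0"
      using empty.prems(4)[of f] by (auto simp: poly_eq_iff)
    thus ?thesis by simp
  qed
  hence "\<exists>u\<in>U. u \<noteq> 0 \<and> order \<xi> u = k" for k
    by (intro bexI[of _ "[:- \<xi>, 1:] ^ k"]) (auto simp: order_power_n_n)
  thus ?case by simp
next
  case (insert j F)
  define V where "V = {u + monom a j |u a. u \<in> U}"
  have "finite {k. \<not> (\<exists>u\<in>V. u \<noteq> 0 \<and> order \<xi> u = k)}"
  proof (rule insert.IH)
    show "0 \<in> V" unfolding V_def using insert.prems(1) by (force intro: exI[of _ 0])
    show "u + v \<in> V" if uv: "u \<in> V" "v \<in> V" for u v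
    proof -
      obtain u' v' a b where "u = u' + monom a j" "u' \<in> U" "v = v' + monom b j" "v' \<in> U"
        using uv unfolding V_def by blast
      moreover from this have "u + v = (u' + v') + monom (a + b) j"
        by (simp add: add_monom[symmetric])
      ultimately show ?thesis unfolding V_def using insert.prems(2) by blast
    qed
    show "smult c u \<in> V" if u: "u \<in> V" for u c
    proof -
      obtain u' a where "u = u' + monom a j" "u' \<in> U"
        using u unfolding V_def by blast
      moreover from this have "smult c u = smult c u' + monom (c * a) j"
        by (simp add: smult_add_right smult_monom)
      ultimately show ?thesis unfolding V_def using insert.prems(3) by blast
    qed
    show "\<exists>u\<in>V. \<forall>i. coeff (f - u) i \<noteq> 0 \<longrightarrow> i \<in> F" for f
    proof -
      obtain u where u: "u \<in> U" "\<forall>i. coeff (f - u) i \<noteq> 0 \<longrightarrow> i \<in> insert j F"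
        using insert.prems(4) by blast
      have "u + monom (coeff (f - u) j) j \<in> V" unfolding V_def using u(1) by blast
      moreover have "\<forall>i. coeff (f - (u + monom (coeff (f - u) j) j)) i \<noteq> 0 \<longrightarrow> i \<in> F"
        using u(2) by auto
      ultimately show ?thesis by blast
    qed
  qed
  moreover define A where "A = {k. (\<exists>u\<in>V. u \<noteq> 0 \<and> order \<xi> u = k) \<and> \<not> (\<exists>u\<in>U. u \<noteq> 0 \<and> order \<xi> u = k)}"
  have "\<not> k < l" if k: "k \<in> A" and l: "l \<in> A" for k l
  proof
    assume "k < l"
    obtain u a where u: "u \<in> U" "u + monom a j \<noteq> 0" "order \<xi> (u + monom a j) = k"
      using k unfolding A_def V_def by blast
    obtain v b where v: "v \<in> U" "v + monom b j \<noteq> 0" "order \<xi> (v + monom b j) = l"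
      using l unfolding A_def V_def by blast
    have "a \<noteq> 0" "b \<noteq> 0"
      using u v k l unfolding A_def by (auto split: if_splits)
    \<comment> \<open>This combination cancels the two monomials, so it lies in \<open>U\<close>,
      and it retains the smaller order \<open>k\<close>.\<close>
    define w where "w = smult b u + smult (- a) v"
    have "w \<in> U" using u v insert.prems unfolding w_def by blast
    have w: "w = smult b (u + monom a j) - smult a (v + monom b j)"
      by (simp add: w_def smult_add_right smult_monom mult.commute)
    have "fls_subdegree (expansion \<xi> w) = int k \<and> w \<noteq> 0"
    proof -
      have "fls_subdegree (expansion \<xi> (smult b (u + monom a j))) = int k"
        "fls_subdegree (expansion \<xi> (smult a (v + monom b j))) = int l"
        using u v \<open>a \<noteq> 0\<close> \<open>b \<noteq> 0\<close> by (simp_all add: subdegree_expansion order_smult del: smult_add_right)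
      moreover have "expansion \<xi> (smult b (u + monom a j)) \<noteq> 0"
        using u \<open>b \<noteq> 0\<close> by (simp del: smult_add_right)
      ultimately have "expansion \<xi> w $$ int k \<noteq> 0" "\<forall>i<int k. expansion \<xi> w $$ i = 0"
        unfolding w expansion_diff using \<open>k < l\<close> nth_fls_subdegree_nonzero[of "expansion \<xi> (smult b (u + monom a j))"]
        by (simp_all del: nth_fls_subdegree_nonzero smult_add_right)
      hence "fls_subdegree (expansion \<xi> w) = int k" "expansion \<xi> w \<noteq> 0"
        by (auto intro: fls_subdegree_eqI)
      thus ?thesis by auto
    qed
    hence "w \<noteq> 0" "order \<xi> w = k" by (auto simp: subdegree_expansion)
    with \<open>w \<in> U\<close> k show False unfolding A_def by blast
  qed
  hence "A \<subseteq> {k}" if "k \<in> A" for k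
    using that by (auto intro: antisym simp: not_less)
  hence "finite A"
    by (metis ex_in_conv finite.emptyI finite_insert finite_subset)
  ultimately have "finite ({k. \<not> (\<exists>u\<in>V. u \<noteq> 0 \<and> order \<xi> u = k)} \<union> A)" by simp
  thus ?case by (rule rev_finite_subset) (auto simp: A_def)
qed

text \<open>The bound is an integer so that \<open>pderiv\<close> lowers it by one even for constants.\<close>

definition degle :: "'a::comm_ring_1 poly \<Rightarrow> int \<Rightarrow> bool" where
  "degle f k \<longleftrightarrow> (\<forall>j. int j > k \<longrightarrow> coeff f j = 0)"

lemma degle_degree: "degle f (int (degree f))"
  by (simp add: degle_def coeff_eq_0)

lemma degle_mono: "degle f k \<Longrightarrow> k \<le> l \<Longrightarrow> degle f l"
  by (auto simp: degle_def)

lemma degle_add: "degle f k \<Longrightarrow> degle g k \<Longrightarrow> degle (f + g) k"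
  and degle_diff: "degle f k \<Longrightarrow> degle g k \<Longrightarrow> degle (f - g) k"
  and degle_smult: "degle f k \<Longrightarrow> degle (smult a f) k"
  by (simp_all add: degle_def)

lemma degle_mult:
  assumes "degle f k" "degle g l"
  shows "degle (f * g) (k + l)"
  unfolding degle_def coeff_mult
proof (intro allI impI sum.neutral ballI)
  fix j i assume "k + l < int j" "i \<in> {..j}"
  hence "int i > k \<or> int (j - i) > l" by auto
  thus "coeff f i * coeff g (j - i) = 0"
    using assms by (auto simp: degle_def)
qed

lemma degle_pderiv: "degle f k \<Longrightarrow> degle (pderiv f) (k - 1)"
  by (auto simp: degle_def coeff_pderiv)

lemma degle_imp_degree_le: "degle f (int k) \<Longrightarrow> degree f \<le> k"
  by (auto simp: degle_def intro: degree_le)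

lemma coeff_mult_top:
  fixes f g :: "'a::comm_ring_1 poly"
  assumes "degle f (int k)" "degle g (int l)"
  shows "coeff (f * g) (k + l) = coeff f k * coeff g l"
proof -
  have "coeff (f * g) (k + l) = (\<Sum>i\<le>k + l. if i = k then coeff f k * coeff g l else 0)"
    unfolding coeff_mult
  proof (intro sum.cong refl)
    fix i assume "i \<in> {..k + l}"
    thus "coeff f i * coeff g (k + l - i) = (if i = k then coeff f k * coeff g l else 0)"
      using assms by (cases i k rule: linorder_cases) (auto simp: degle_def)
  qed
  thus ?thesis by simp
qed

lemma degle_quotient:
  fixes f g :: "'a::idom poly"
  assumes "degle (f * g) (int (degree f) + int k)" "f \<noteq> 0"
  shows "degree g \<le> k"
proof (cases "g = 0")
  case False
  thus ?thesis
    using assms degle_imp_degree_le[of "f * g" "degree f + k"] by (simp add: degree_mult_eq)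
qed simp

section \<open>Eigenvalue equations over a common denominator, and the span of the
  eigenpolynomials\<close>

abbreviation jacobi_p :: "real poly" where "jacobi_p \<equiv> [:-1, 0, 1:]"

locale reduced_operator =
  fixes d B C :: "real poly" and F :: "nat set" and P :: "nat \<Rightarrow> real poly" and lam :: "nat \<Rightarrow> real"
  assumes d_nonzero: "d \<noteq> 0" and finite_F: "finite F"
    and P_nonzero: "n \<notin> F \<Longrightarrow> P n \<noteq> 0" and degree_P: "n \<notin> F \<Longrightarrow> degree (P n) = n"
    and eigen: "n \<notin> F \<Longrightarrow>
      jacobi_p * d * pderiv (pderiv (P n)) + B * pderiv (P n) + C * P n = smult (lam n) (d * P n)"
    and no_common_root: "\<exists>n. n \<notin> F \<and> poly (cpoly (P n)) \<xi> \<noteq> 0"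
begin

text \<open>At the largest excess degree \<open>e\<close>, the coefficient of degree
  \<open>e + n\<close> in the equation for \<open>P n\<close> gives a relation affine in
  \<open>n\<close>. Two admissible values of \<open>n\<close> make both of its coefficients
  vanish.\<close>

lemma degree_bounds: "degle B (int (degree d) + 1)" "degle C (int (degree d))"
proof -
  define S where "S = {e. e > degree d \<and> (coeff B (Suc e) \<noteq> 0 \<or> coeff C e \<noteq> 0)}"
  have "S = {}"
  proof (rule ccontr)
    assume "S \<noteq> {}"
    have "S \<subseteq> {..max (degree B) (degree C)}"
      by (auto simp: S_def dest!: le_degree)
    hence "finite S" by (rule finite_subset) auto
    define e where "e = Max S"
    have "e \<in> S" and e_max: "\<And>i. i > e \<Longrightarrow> i \<notin> S"
      using Max_in[OF \<open>finite S\<close> \<open>S \<noteq> {}\<close>] Max_ge[OF \<open>finite S\<close>] by (auto simp: e_def not_le[symmetric])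
    hence e: "degree d < e" by (simp add: S_def)
    have vanish: "coeff B (Suc i) = 0 \<and> coeff C i = 0" if "i > e" for i
      using e_max[OF that] that e by (auto simp: S_def)
    have B: "degle B (int (Suc e))"
      unfolding degle_def
    proof (intro allI impI)
      fix j assume "int j > int (Suc e)"
      then obtain i where "j = Suc i" "i > e" by (cases j) auto
      thus "coeff B j = 0" using vanish by auto
    qed
    have C: "degle C (int e)" using vanish by (auto simp: degle_def)
    have lin: "real n * coeff B (Suc e) + coeff C e = 0" if n: "n \<notin> F" "n > 0" for n
    proof -
      have P: "degle (P n) (int n)" using degle_degree[of "P n"] degree_P[OF n(1)] by simp
      have P': "degle (pderiv (P n)) (int (n - 1))"
        using degle_pderiv[OF P] n(2) by (simp add: of_nat_diff)
      have idx: "Suc e + (n - 1) = e + n" using n(2) by simp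
      have p: "degle jacobi_p 2"
        using degle_degree[of jacobi_p] by simp
      have "degle (jacobi_p * d * pderiv (pderiv (P n))) (2 + int (degree d) + (int n - 1 - 1))"
        by (intro degle_mult p degle_pderiv P degle_degree)
      hence 1: "coeff (jacobi_p * d * pderiv (pderiv (P n))) (e + n) = 0"
        using e by (simp add: degle_def)
      have 2: "coeff (B * pderiv (P n)) (e + n) = coeff B (Suc e) * (real n * coeff (P n) n)"
        using coeff_mult_top[OF B P'] n(2) unfolding idx by (simp add: coeff_pderiv)
      have 3: "coeff (C * P n) (e + n) = coeff C e * coeff (P n) n"
        by (rule coeff_mult_top[OF C P])
      have "degle (smult (lam n) (d * P n)) (int (degree d) + int n)"
        by (intro degle_smult degle_mult degle_degree P)
      hence 4: "coeff (smult (lam n) (d * P n)) (e + n) = 0"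
        using e by (simp add: degle_def del: coeff_smult)
      have "coeff B (Suc e) * (real n * coeff (P n) n) + coeff C e * coeff (P n) n = 0"
        using arg_cong[OF eigen[OF n(1)], of "\<lambda>f. coeff f (e + n)"] 1 2 3 4
        by (simp del: coeff_smult mult_pCons_left mult_pCons_right)
      hence "coeff (P n) n * (real n * coeff B (Suc e) + coeff C e) = 0"
        by (simp add: algebra_simps)
      moreover have "coeff (P n) n \<noteq> 0"
        using P_nonzero[OF n(1)] degree_P[OF n(1)] by (metis leading_coeff_0_iff)
      ultimately show ?thesis by simp
    qed
    have inf: "infinite (- insert 0 F)" using finite_F by (simp add: Compl_eq_Diff_UNIV)
    then obtain n where n: "n \<in> - insert 0 F" by (metis ex_in_conv finite.emptyI)
    from inf have "infinite (- insert 0 F - {n})" by simp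
    then obtain m where m: "m \<in> - insert 0 F - {n}" by (metis ex_in_conv finite.emptyI)
    have "real n * coeff B (Suc e) + coeff C e = 0" "real m * coeff B (Suc e) + coeff C e = 0"
      using lin[of n] lin[of m] n m by auto
    hence "(real n - real m) * coeff B (Suc e) = 0"
      unfolding left_diff_distrib by linarith
    hence "coeff B (Suc e) = 0" using m by simp
    moreover from this have "coeff C e = 0" using lin[of n] n by simp
    ultimately show False using \<open>e \<in> S\<close> by (simp add: S_def)
  qed
  hence *: "coeff B (Suc e) = 0 \<and> coeff C e = 0" if "e > degree d" for e
    using that by (auto simp: S_def)
  show "degle C (int (degree d))" using * by (auto simp: degle_def)
  show "degle B (int (degree d) + 1)"
    unfolding degle_def
  proof (intro allI impI)
    fix j assume "int j > int (degree d) + 1"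
    then obtain i where "j = Suc i" "i > degree d" by (cases j) auto
    thus "coeff B j = 0" using * by auto
  qed
qed

text \<open>The span has complex scalars because orders are studied at complex points; since its
  generators are real, it is also closed under conjugation.\<close>

inductive_set U :: "complex poly set" where
  zero: "0 \<in> U"
| step: "n \<notin> F \<Longrightarrow> u \<in> U \<Longrightarrow> smult a (cpoly (P n)) + u \<in> U"

lemma P_in_U: "n \<notin> F \<Longrightarrow> cpoly (P n) \<in> U"
  using U.step[OF _ U.zero, of n 1] by simp

lemma U_add: "u \<in> U \<Longrightarrow> v \<in> U \<Longrightarrow> u + v \<in> U"
  by (induction u rule: U.induct) (auto simp: add.assoc intro: U.step)

lemma U_smult: "u \<in> U \<Longrightarrow> smult c u \<in> U"
  by (induction u rule: U.induct) (auto simp: smult_add_right intro: U.intros)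

lemma U_cnj: "u \<in> U \<Longrightarrow> map_poly cnj u \<in> U"
  by (induction u rule: U.induct) (auto simp: map_poly_cnj_add map_poly_cnj_smult intro: U.intros)

text \<open>Elimination from the top degree: a coefficient of degree \<open>n \<notin> F\<close> is
  cancelled by a multiple of \<open>P n\<close>, and one of degree \<open>n \<in> F\<close> is left
  in the remainder.\<close>

lemma U_spans: "\<exists>u\<in>U. \<forall>j. coeff (f - u) j \<noteq> 0 \<longrightarrow> j \<in> F"
proof -
  have "\<exists>u\<in>U. \<forall>j. coeff (f - u) j \<noteq> 0 \<longrightarrow> j \<in> F" if "\<forall>j\<ge>n. coeff f j = 0" for n
    using that
  proof (induction n arbitrary: f)
    case 0
    thus ?case by (intro bexI[OF _ U.zero]) auto
  next
    case (Suc n)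
    show ?case
    proof (cases "n \<in> F")
      case True
      define g where "g = f - monom (coeff f n) n"
      have "\<forall>j\<ge>n. coeff g j = 0"
        using Suc.prems by (auto simp: g_def le_Suc_eq not_less_eq_eq)
      from Suc.IH[OF this] obtain u where u: "u \<in> U" "\<forall>j. coeff (g - u) j \<noteq> 0 \<longrightarrow> j \<in> F" by blast
      have "\<forall>j. coeff (f - u) j \<noteq> 0 \<longrightarrow> j \<in> F"
      proof (intro allI impI)
        fix j assume "coeff (f - u) j \<noteq> 0"
        thus "j \<in> F"
          using u(2)[rule_format, of j] True by (cases "j = n") (auto simp: g_def)
      qed
      with u(1) show ?thesis by blast
    next
      case False
      have lc: "coeff (P n) n \<noteq> 0"
        using P_nonzero[OF False] degree_P[OF False] by (metis leading_coeff_0_iff)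
      define v where "v = smult (coeff f n / of_real (coeff (P n) n)) (cpoly (P n))"
      have "\<forall>j\<ge>n. coeff (f - v) j = 0"
      proof (intro allI impI)
        fix j assume "n \<le> j"
        show "coeff (f - v) j = 0"
        proof (cases "j = n")
          case True
          thus ?thesis using lc by (simp add: v_def)
        next
          case False
          hence "coeff (P n) j = 0" "coeff f j = 0"
            using \<open>n \<le> j\<close> degree_P[OF \<open>n \<notin> F\<close>] Suc.prems by (auto intro: coeff_eq_0)
          thus ?thesis by (simp add: v_def)
        qed
      qed
      from Suc.IH[OF this] obtain u where u: "u \<in> U" "\<forall>j. coeff (f - v - u) j \<noteq> 0 \<longrightarrow> j \<in> F" by blast
      have "v + u \<in> U" unfolding v_def by (intro U.step False u)
      moreover have "f - (v + u) = f - v - u" by simp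
      ultimately show ?thesis using u(2) by metis
    qed
  qed
  from this[of "Suc (degree f)"] show ?thesis by (auto simp: coeff_eq_0)
qed

lemma U_invariant:
  assumes "u \<in> U"
  shows "\<exists>w\<in>U. cpoly jacobi_p * cpoly d * pderiv (pderiv u) + cpoly B * pderiv u + cpoly C * u = cpoly d * w"
  using assms
proof (induction u rule: U.induct)
  case zero
  show ?case by (intro bexI[OF _ U.zero]) auto
next
  case (step n u a)
  from step.IH obtain w where w: "w \<in> U"
    "cpoly jacobi_p * cpoly d * pderiv (pderiv u) + cpoly B * pderiv u + cpoly C * u = cpoly d * w" by blast
  let ?Q = "cpoly (P n)"
  have "cpoly jacobi_p * cpoly d * pderiv (pderiv ?Q) + cpoly B * pderiv ?Q + cpoly C * ?Q
      = smult (of_real (lam n)) (cpoly d * ?Q)"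
    using arg_cong[OF eigen[OF step.hyps(1)], of cpoly]
    by (simp only: cpoly_add cpoly_mult cpoly_pderiv cpoly_smult)
  hence "smult a (cpoly jacobi_p * cpoly d * pderiv (pderiv ?Q) + cpoly B * pderiv ?Q + cpoly C * ?Q)
      = smult a (smult (of_real (lam n)) (cpoly d * ?Q))" by simp
  moreover have "cpoly jacobi_p * cpoly d * pderiv (pderiv (smult a ?Q + u))
      + cpoly B * pderiv (smult a ?Q + u) + cpoly C * (smult a ?Q + u)
    = smult a (cpoly jacobi_p * cpoly d * pderiv (pderiv ?Q) + cpoly B * pderiv ?Q + cpoly C * ?Q)
      + (cpoly jacobi_p * cpoly d * pderiv (pderiv u) + cpoly B * pderiv u + cpoly C * u)"
    by (simp add: pderiv_add pderiv_smult algebra_simps smult_add_right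
        del: cpoly_pCons mult_pCons_left mult_pCons_right)
  ultimately have "cpoly jacobi_p * cpoly d * pderiv (pderiv (smult a ?Q + u))
      + cpoly B * pderiv (smult a ?Q + u) + cpoly C * (smult a ?Q + u)
    = cpoly d * (smult (a * of_real (lam n)) ?Q + w)"
    unfolding w(2) by (simp add: distrib_left)
  moreover have "smult (a * of_real (lam n)) ?Q + w \<in> U"
    by (intro U.step step.hyps w)
  ultimately show ?case by blast
qed

abbreviation "pe \<xi> \<equiv> expansion \<xi> (cpoly jacobi_p)"
abbreviation "qe \<xi> \<equiv> expansion \<xi> (cpoly B) / expansion \<xi> (cpoly d)"
abbreviation "re \<xi> \<equiv> expansion \<xi> (cpoly C) / expansion \<xi> (cpoly d)"

sublocale loc: local_operator "pe \<xi>" "qe \<xi>" "re \<xi>" "expansion \<xi> ` U" for \<xi>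
proof
  have orders: "(\<exists>u\<in>expansion \<xi> ` U. u \<noteq> 0 \<and> fls_subdegree u = int k) \<longleftrightarrow> (\<exists>u\<in>U. u \<noteq> 0 \<and> order \<xi> u = k)" for k
    by (auto simp: subdegree_expansion)
  show "finite {k. \<not> (\<exists>u\<in>expansion \<xi> ` U. u \<noteq> 0 \<and> fls_subdegree u = int k)}"
    unfolding orders by (rule finite_missing_orders[OF finite_F U.zero U_add U_smult U_spans])
  obtain n where "n \<notin> F" "poly (cpoly (P n)) \<xi> \<noteq> 0" using no_common_root by blast
  hence "cpoly (P n) \<in> U" "cpoly (P n) \<noteq> 0" "order \<xi> (cpoly (P n)) = 0"
    by (auto simp: P_in_U order_0I)
  thus "\<exists>u\<in>expansion \<xi> ` U. u \<noteq> 0 \<and> fls_subdegree u = 0"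
    using orders[of 0] by (metis of_nat_0)
  show "u $$ j = 0" if "u \<in> expansion \<xi> ` U" "j < 0" for u j
    using that by auto
  show "pe \<xi> $$ j = 0" if "j < 0" for j
    using that by (rule expansion_nth_neg)
  show "pe \<xi> * fls_deriv (fls_deriv u) + qe \<xi> * fls_deriv u + re \<xi> * u \<in> expansion \<xi> ` U"
    if "u \<in> expansion \<xi> ` U" for u
  proof -
    from that obtain v where v: "u = expansion \<xi> v" "v \<in> U" by blast
    from U_invariant[OF v(2)] obtain w where w: "w \<in> U"
      "cpoly jacobi_p * cpoly d * pderiv (pderiv v) + cpoly B * pderiv v + cpoly C * v = cpoly d * w" by blast
    have nz: "expansion \<xi> (cpoly d) \<noteq> 0" using d_nonzero by simp
    have "pe \<xi> * expansion \<xi> (cpoly d) * fls_deriv (fls_deriv u) + expansion \<xi> (cpoly B) * fls_deriv u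
        + expansion \<xi> (cpoly C) * u = expansion \<xi> (cpoly d) * expansion \<xi> w"
      using arg_cong[OF w(2), of "expansion \<xi>"]
      by (simp only: expansion_add expansion_mult expansion_pderiv v(1))
    hence "pe \<xi> * fls_deriv (fls_deriv u) + qe \<xi> * fls_deriv u + re \<xi> * u = expansion \<xi> w"
      using nz by (simp add: field_simps del: cpoly_pCons)
    thus ?thesis using w(1) by simp
  qed
qed

end

section \<open>From the local residues to the global natural form\<close>

context reduced_operator
begin

text \<open>The value \<open>0\<close> at \<open>1\<close> and \<open>-1\<close> reflects the
  regularity of \<open>q\<close> and \<open>r\<close> there, and lets one residue formula hold at
  every point.\<close>

definition pole :: "complex \<Rightarrow> nat" where
  "pole \<xi> = (if \<xi> = 1 \<or> \<xi> = -1 then 0 else loc.nu \<xi>)"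

lemma pe_nth_0: "pe \<xi> $$ 0 = \<xi>\<^sup>2 - 1"
  by (simp add: expansion_nth_0 power2_eq_square)

lemma pe_nth_0_eq_0_iff: "pe \<xi> $$ 0 = 0 \<longleftrightarrow> \<xi> = 1 \<or> \<xi> = -1"
  unfolding pe_nth_0 by (simp add: power2_eq_1_iff)

text \<open>Conjugation preserves \<open>U\<close> and carries orders at \<open>\<xi>\<close> to
  orders at \<open>cnj \<xi>\<close>. The resulting symmetry of \<open>pole\<close> is what makes
  \<open>\<sigma>\<close> and \<open>N\<close> real.\<close>

lemma loc_I_cnj: "loc.I (cnj \<xi>) = loc.I \<xi>"
proof -
  have sub: "loc.I \<xi> \<subseteq> loc.I (cnj \<xi>)" for \<xi>
  proof
    fix k assume "k \<in> loc.I \<xi>"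
    then obtain u where u: "u \<in> U" "u \<noteq> 0" "order \<xi> u = k"
      unfolding loc.I_def by (auto simp: subdegree_expansion)
    hence "map_poly cnj u \<in> U" "map_poly cnj u \<noteq> 0" "order (cnj \<xi>) (map_poly cnj u) = k"
      by (auto simp: U_cnj order_map_poly_cnj)
    thus "k \<in> loc.I (cnj \<xi>)"
      unfolding loc.I_def by (auto simp: subdegree_expansion intro!: bexI[of _ "map_poly cnj u"])
  qed
  show ?thesis using sub[of \<xi>] sub[of "cnj \<xi>"] by auto
qed

lemma pole_cnj: "pole (cnj \<xi>) = pole \<xi>"
proof -
  have "cnj \<xi> = 1 \<longleftrightarrow> \<xi> = 1" "cnj \<xi> = -1 \<longleftrightarrow> \<xi> = -1"
    by (auto simp: complex_eq_iff)
  thus ?thesis unfolding pole_def loc.nu_def loc_I_cnj by simp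
qed

lemma leading2_pe: "leading2 0 (pe \<xi>) (pe \<xi> $$ 0) (pe \<xi> $$ 1)"
  by (simp add: leading2_def del: cpoly_pCons)

lemma leading2_qe: "leading2 (-1) (qe \<xi>) (- (2 * of_nat (pole \<xi>) * pe \<xi> $$ 0)) (qe \<xi> $$ 0)"
proof (cases "\<xi> = 1 \<or> \<xi> = -1")
  case True
  hence "pe \<xi> $$ 0 = 0" by (simp only: pe_nth_0_eq_0_iff)
  from loc.regular_at_zero_of_p(1)[OF this] show ?thesis
    using True by (auto simp: leading2_def pole_def)
next
  case False
  hence "pe \<xi> $$ 0 \<noteq> 0" by (simp only: pe_nth_0_eq_0_iff simp_thms)
  from loc.poles_off_zero_of_p(1)[OF this] loc.residue_q[OF this] show ?thesis
    using False by (auto simp: leading2_def pole_def simp del: cpoly_pCons)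
qed

lemma leading2_re:
  "leading2 (-1) (re \<xi>)
     (of_nat (pole \<xi>) * ((1 - 3 * of_nat (pole \<xi>)) / 2 * pe \<xi> $$ 1 - qe \<xi> $$ 0)) (re \<xi> $$ 0)"
proof (cases "\<xi> = 1 \<or> \<xi> = -1")
  case True
  hence "pe \<xi> $$ 0 = 0" by (simp only: pe_nth_0_eq_0_iff)
  from loc.regular_at_zero_of_p(2)[OF this] show ?thesis
    using True by (auto simp: leading2_def pole_def)
next
  case False
  hence "pe \<xi> $$ 0 \<noteq> 0" by (simp only: pe_nth_0_eq_0_iff simp_thms)
  from loc.poles_off_zero_of_p(2)[OF this] loc.residue_r[OF this] show ?thesis
    using False by (auto simp: leading2_def pole_def simp del: cpoly_pCons)
qed

text \<open>A nonzero \<open>pole \<xi>\<close> gives \<open>q\<close> a nonzero residue, which is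
  possible only at a root of \<open>d\<close>.\<close>

lemma finite_poles: "finite {\<xi>. pole \<xi> \<noteq> 0}"
proof (rule finite_subset)
  show "finite {\<xi>. poly (cpoly d) \<xi> = 0}"
    using d_nonzero by (simp add: poly_roots_finite)
  show "{\<xi>. pole \<xi> \<noteq> 0} \<subseteq> {\<xi>. poly (cpoly d) \<xi> = 0}"
  proof
    fix \<xi> assume "\<xi> \<in> {\<xi>. pole \<xi> \<noteq> 0}"
    hence "pole \<xi> \<noteq> 0" by simp
    hence p0: "pe \<xi> $$ 0 \<noteq> 0"
      unfolding pe_nth_0_eq_0_iff by (auto simp: pole_def)
    show "\<xi> \<in> {\<xi>. poly (cpoly d) \<xi> = 0}"
    proof (rule ccontr)
      assume "\<xi> \<notin> {\<xi>. poly (cpoly d) \<xi> = 0}"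
      hence nz: "poly (cpoly d) \<xi> \<noteq> 0" by simp
      have "fls_subdegree (expansion \<xi> (cpoly d)) = 0"
        using nz by (intro fls_subdegree_eqI) (auto simp: expansion_nth_0)
      hence "qe \<xi> $$ (-1) = 0"
        using fls_divide_subdegree[of "expansion \<xi> (cpoly B)" "expansion \<xi> (cpoly d)"] d_nonzero
          subdegree_expansion[of "cpoly B" \<xi>]
        by (cases "B = 0") (auto intro!: fls_eq0_below_subdegree)
      thus False
        using leading2_qe[of \<xi>] p0 \<open>pole \<xi> \<noteq> 0\<close> by (simp add: leading2_def)
    qed
  qed
qed

lemma nonzero_cpoly_at: "order (of_real x) (cpoly f) = 0 \<Longrightarrow> f \<noteq> 0 \<Longrightarrow> poly f x \<noteq> 0"
  using order_root[of "cpoly f" "of_real x"] by auto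

text \<open>Divided by the factors on the left and by \<open>d\<close>, the two equations say that
  the operator is the natural form for \<open>\<sigma> * N\<close>, conjugated by multiplication
  with \<open>1 / N\<close> and shifted by \<open>c\<close>, with \<open>L\<close> in the role of
  \<open>(x^2 - 1) * eta\<close>.\<close>

lemma natural_form:
  obtains \<sigma> N L :: "real poly" and c :: real
  where "poly \<sigma> 1 \<noteq> 0" "poly \<sigma> (-1) \<noteq> 0" "poly N 1 \<noteq> 0" "poly N (-1) \<noteq> 0" "degree L \<le> 1"
    "B * \<sigma> = d * (L * \<sigma> - 2 * (jacobi_p * pderiv \<sigma>))"
    "C * \<sigma> * N\<^sup>2 = d * (jacobi_p * pderiv (pderiv \<sigma>) * N\<^sup>2
        + 2 * (jacobi_p * \<sigma> * (pderiv (pderiv N) * N - (pderiv N)\<^sup>2)) - L * pderiv \<sigma> * N\<^sup>2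
        + pderiv jacobi_p * (pderiv \<sigma> * N\<^sup>2 + \<sigma> * N * pderiv N) + smult c (\<sigma> * N\<^sup>2))"
proof -
  \<comment> \<open>This order of \<open>N\<close> is forced by the double pole of \<open>X\<close>
    below, whose coefficient is \<open>p $$ 0\<close> times \<open>k * k - k - 2 * g k\<close> up to
    sign, where \<open>k = pole \<xi>\<close>.\<close>
  define g where "g m = m * (m - 1) div 2" for m :: nat
  have g: "of_nat (g m) = (of_nat m * (of_nat m - 1) / 2 :: complex)" for m
  proof -
    have "even (m * (m - 1))" by (cases m) auto
    hence "2 * g m = m * (m - 1)" unfolding g_def by (rule dvd_mult_div_cancel)
    hence "of_nat (2 * g m) = (of_nat (m * (m - 1)) :: complex)" by simp
    also have "\<dots> = of_nat m * (of_nat m - 1)"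
      by (cases m) (auto simp: algebra_simps)
    finally show ?thesis by (simp add: mult.commute)
  qed
  obtain \<sigma> where \<sigma>: "\<sigma> \<noteq> 0" "\<And>\<xi>. order \<xi> (cpoly \<sigma>) = pole \<xi>"
    using real_poly_with_orders[of pole] finite_poles pole_cnj by metis
  have "finite {\<xi>. g (pole \<xi>) \<noteq> 0}"
    by (rule finite_subset[OF _ finite_poles]) (auto simp: g_def)
  then obtain N where N: "N \<noteq> 0" "\<And>\<xi>. order \<xi> (cpoly N) = g (pole \<xi>)"
    using real_poly_with_orders[of "\<lambda>\<xi>. g (pole \<xi>)"] pole_cnj by metis
  have at_1: "poly \<sigma> 1 \<noteq> 0" "poly \<sigma> (-1) \<noteq> 0" "poly N 1 \<noteq> 0" "poly N (-1) \<noteq> 0"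
    using nonzero_cpoly_at[of 1 \<sigma>] nonzero_cpoly_at[of "-1" \<sigma>]
      nonzero_cpoly_at[of 1 N] nonzero_cpoly_at[of "-1" N] \<sigma>(1) N(1)
    by (simp_all add: \<sigma>(2) N(2)) (simp_all add: pole_def g_def)
  define se where "se \<xi> = fls_deriv (expansion \<xi> (cpoly \<sigma>)) / expansion \<xi> (cpoly \<sigma>)" for \<xi>
  define ne where "ne \<xi> = fls_deriv (expansion \<xi> (cpoly N)) / expansion \<xi> (cpoly N)" for \<xi>
  have se: "leading2 (-1) (se \<xi>) (of_nat (pole \<xi>)) (se \<xi> $$ 0)" for \<xi>
    using leading2_log_deriv[of "expansion \<xi> (cpoly \<sigma>)"] \<sigma> by (simp add: se_def subdegree_expansion)
  have ne: "leading2 (-1) (ne \<xi>) (of_nat (g (pole \<xi>))) (ne \<xi> $$ 0)" for \<xi>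
    using leading2_log_deriv[of "expansion \<xi> (cpoly N)"] N by (simp add: ne_def subdegree_expansion)

  \<comment> \<open>\<open>E / (d * \<sigma>)\<close> is \<open>q\<close> plus twice
    \<open>p\<close> times the logarithmic derivative of \<open>\<sigma>\<close>; by
    \<open>leading2_qe\<close> the simple poles cancel.\<close>
  define E where "E = B * \<sigma> + 2 * (d * jacobi_p * pderiv \<sigma>)"
  have "d * \<sigma> dvd E"
  proof (rule dvd_by_expansions)
    show "d * \<sigma> \<noteq> 0" using d_nonzero \<sigma> by simp
    fix \<xi> and j :: int assume "j < 0"
    have "expansion \<xi> (cpoly E) / expansion \<xi> (cpoly (d * \<sigma>)) = qe \<xi> + (pe \<xi> * se \<xi> + pe \<xi> * se \<xi>)"
      using d_nonzero \<sigma> unfolding E_def se_def mult_2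
      by (simp only: expansion_add expansion_mult expansion_pderiv cpoly_add cpoly_mult cpoly_pderiv)
         (simp add: field_simps del: cpoly_pCons)
    moreover define p where "p = pe \<xi>"
    note 1 = leading2_mult[OF leading2_pe[of \<xi>, folded p_def] se[of \<xi>], simplified]
    have "leading2 (-1) (qe \<xi> + (p * se \<xi> + p * se \<xi>)) 0
        (qe \<xi> $$ 0 + 2 * (p $$ 0 * se \<xi> $$ 0 + p $$ 1 * of_nat (pole \<xi>)))"
      by (rule leading2_cong[OF leading2_add[OF leading2_qe[of \<xi>, folded p_def] leading2_add[OF 1 1]]]) auto
    ultimately show "(expansion \<xi> (cpoly E) / expansion \<xi> (cpoly (d * \<sigma>))) $$ j = 0"
      using \<open>j < 0\<close> unfolding p_def by (cases "j = -1") (auto simp: leading2_def simp del: cpoly_pCons)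
  qed
  then obtain L where L: "E = d * \<sigma> * L" by (elim dvdE)
  have p: "degle jacobi_p 2"
    using degle_degree[of jacobi_p] by simp
  have "degle E (int (degree (d * \<sigma>)) + int 1)"
  proof -
    have 1: "degle (B * \<sigma>) (int (degree d) + int (degree \<sigma>) + 1)"
      by (rule degle_mono[OF degle_mult[OF degree_bounds(1) degle_degree]]) simp
    have 2: "degle (d * jacobi_p * pderiv \<sigma>) (int (degree d) + int (degree \<sigma>) + 1)"
      by (rule degle_mono[OF degle_mult[OF degle_mult[OF degle_degree p] degle_pderiv[OF degle_degree]]]) simp
    show ?thesis
      using degle_add[OF 1 degle_add[OF 2 2]] d_nonzero \<sigma>(1)
      unfolding E_def mult_2 by (simp add: degree_mult_eq algebra_simps del: mult_pCons_left mult_pCons_right)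
  qed
  hence degree_L: "degree L \<le> 1"
    unfolding L using d_nonzero \<sigma>(1) by (intro degle_quotient[of "d * \<sigma>"]) auto
  have L_eq: "B * \<sigma> = d * (L * \<sigma> - 2 * (jacobi_p * pderiv \<sigma>))"
    using L unfolding E_def by (simp only: algebra_simps)

  \<comment> \<open>Squares and doubled terms are written out so that the rules for sums,
    differences and products suffice to transport \<open>H\<close> through \<open>cpoly\<close> and
    \<open>expansion\<close>.\<close>
  define H where "H = C * \<sigma> * (N * N) - d * (jacobi_p * pderiv (pderiv \<sigma>) * (N * N)
        + (jacobi_p * \<sigma> * (pderiv (pderiv N) * N - pderiv N * pderiv N)
          + jacobi_p * \<sigma> * (pderiv (pderiv N) * N - pderiv N * pderiv N)) - L * pderiv \<sigma> * (N * N)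
        + pderiv jacobi_p * (pderiv \<sigma> * (N * N) + \<sigma> * N * pderiv N))"
  have "d * \<sigma> * (N * N) dvd H"
  proof (rule dvd_by_expansions)
    show "d * \<sigma> * (N * N) \<noteq> 0" using d_nonzero \<sigma> N by simp
    fix \<xi> and j :: int assume "j < 0"
    define D where "D = expansion \<xi> (cpoly d)"
    define S where "S = expansion \<xi> (cpoly \<sigma>)"
    define n where "n = expansion \<xi> (cpoly N)"
    define p where "p = pe \<xi>"
    define q where "q = qe \<xi>"
    define r where "r = re \<xi>"
    define s where "s = se \<xi>"
    define m where "m = ne \<xi>"
    have nz: "D \<noteq> 0" "S \<noteq> 0" "n \<noteq> 0"
      using d_nonzero \<sigma> N by (simp_all add: D_def S_def n_def)
    have S': "fls_deriv S = S * s" and n': "fls_deriv n = n * m"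
      using nz by (simp_all add: s_def m_def se_def ne_def S_def n_def)
    have C': "expansion \<xi> (cpoly C) = D * r"
      using nz by (simp add: r_def D_def)
    have B': "expansion \<xi> (cpoly B) = D * q"
      using nz by (simp add: q_def D_def)
    have "D * S * expansion \<xi> (cpoly L) = D * S * (q + (p * s + p * s))"
      using arg_cong[OF L, of "\<lambda>f. expansion \<xi> (cpoly f)"] unfolding E_def mult_2
      by (simp only: expansion_add expansion_mult expansion_pderiv cpoly_add cpoly_mult cpoly_pderiv
          flip: D_def S_def p_def) (simp add: S' B' algebra_simps)
    hence L': "expansion \<xi> (cpoly L) = q + (p * s + p * s)"
      using nz by simp
    define X where "X = r - (p * (s * s + fls_deriv s + (fls_deriv m + fls_deriv m))
        - (q + (p * s + p * s)) * s + fls_deriv p * (s + m))"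
    have "expansion \<xi> (cpoly H) = D * S * (n * n) * X"
      unfolding H_def
      by (simp only: expansion_add expansion_diff expansion_mult expansion_pderiv cpoly_add cpoly_diff
          cpoly_mult cpoly_pderiv flip: D_def S_def n_def p_def)
         (simp only: S' n' L' C' X_def, simp add: S' n' algebra_simps)
    moreover have "expansion \<xi> (cpoly (d * \<sigma> * (N * N))) = D * S * (n * n)"
      by (simp only: expansion_mult cpoly_mult D_def S_def n_def)
    ultimately have quot: "expansion \<xi> (cpoly H) / expansion \<xi> (cpoly (d * \<sigma> * (N * N))) = X"
      using nz by simp
    let ?k = "of_nat (pole \<xi>) :: complex"
    let ?g = "of_nat (g (pole \<xi>)) :: complex"
    note P = leading2_pe[of \<xi>, folded p_def]
      and Q = leading2_qe[of \<xi>, folded p_def q_def]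
      and R = leading2_lower[OF leading2_re[of \<xi>, folded p_def q_def r_def]]
      and Se = se[of \<xi>, folded s_def] and Ne = ne[of \<xi>, folded m_def]
    have ss: "leading2 (-2) (s * s) (?k * ?k) (?k * s $$ 0 + s $$ 0 * ?k)"
      by (rule leading2_cong[OF leading2_mult[OF Se Se]]) auto
    have s': "leading2 (-2) (fls_deriv s) (- ?k) 0"
      by (rule leading2_cong[OF leading2_deriv[OF Se]]) auto
    have m': "leading2 (-2) (fls_deriv m) (- ?g) 0"
      by (rule leading2_cong[OF leading2_deriv[OF Ne]]) auto
    have p': "leading2 (-1) (fls_deriv p) 0 (p $$ 1)"
      by (rule leading2_cong[OF leading2_deriv[OF P]]) auto
    have ps: "leading2 (-1) (p * s) (p $$ 0 * ?k) (p $$ 0 * s $$ 0 + p $$ 1 * ?k)"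
      by (rule leading2_cong[OF leading2_mult[OF P Se]]) auto
    have 1: "leading2 (-2) (p * (s * s + fls_deriv s + (fls_deriv m + fls_deriv m)))
        (p $$ 0 * (?k * ?k - ?k - 2 * ?g)) (p $$ 0 * (2 * ?k * s $$ 0) + p $$ 1 * (?k * ?k - ?k - 2 * ?g))"
      by (rule leading2_cong[OF leading2_mult[OF P leading2_add[OF leading2_add[OF ss s'] leading2_add[OF m' m']]]])
         auto
    have 2: "leading2 (-2) ((q + (p * s + p * s)) * s) 0
        ((q $$ 0 + 2 * (p $$ 0 * s $$ 0 + p $$ 1 * ?k)) * ?k)"
      by (rule leading2_cong[OF leading2_mult[OF leading2_add[OF Q leading2_add[OF ps ps]] Se]]) auto
    have 3: "leading2 (-2) (fls_deriv p * (s + m)) 0 (p $$ 1 * (?k + ?g))"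
      by (rule leading2_cong[OF leading2_mult[OF p' leading2_add[OF Se Ne]]]) auto
    have R': "leading2 (-2) r 0 (?k * ((1 - 3 * ?k) / 2 * p $$ 1 - q $$ 0))"
      by (rule leading2_cong[OF R]) auto
    \<comment> \<open>The double pole cancels by the choice of \<open>g\<close>. In the residue the
      terms with \<open>s $$ 0\<close> drop out, and the rest is the value supplied by
      \<open>leading2_re\<close>.\<close>
    have "leading2 (-2) X 0 0"
      unfolding X_def
      by (rule leading2_cong[OF leading2_diff[OF R' leading2_add[OF leading2_diff[OF 1 2] 3]]])
         (simp_all add: g field_simps)
    thus "(expansion \<xi> (cpoly H) / expansion \<xi> (cpoly (d * \<sigma> * (N * N)))) $$ j = 0"
      unfolding quot using \<open>j < 0\<close>
      by (cases "j = -1"; cases "j = -2") (auto simp: leading2_def)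
  qed
  then obtain K where K: "H = d * \<sigma> * (N * N) * K" by (elim dvdE)
  have L1: "degle L 1" using degle_mono[OF degle_degree[of L]] degree_L by simp
  have p': "degle (pderiv jacobi_p) 1" using degle_pderiv[OF p] by simp
  have "degle H (int (degree (d * \<sigma> * (N * N))) + int 0)"
  proof -
    let ?s = "int (degree \<sigma>)" and ?n = "int (degree N)"
    note [intro] = degle_degree degle_pderiv p p' L1 degle_mult degree_bounds
    have 1: "degle (jacobi_p * pderiv (pderiv \<sigma>) * (N * N)) (?s + 2 * ?n)"
      by (rule degle_mono[where k = "2 + (?s - 1 - 1) + (?n + ?n)"]) (blast, simp)
    have 2: "degle (jacobi_p * \<sigma> * (pderiv (pderiv N) * N - pderiv N * pderiv N)) (?s + 2 * ?n)"
    proof (rule degle_mono[where k = "2 + ?s + (?n + ?n - 2)"])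
      have "degle (pderiv (pderiv N) * N) (?n + ?n - 2)"
        by (rule degle_mono[where k = "(?n - 1 - 1) + ?n"]) (blast, simp)
      moreover have "degle (pderiv N * pderiv N) (?n + ?n - 2)"
        by (rule degle_mono[where k = "(?n - 1) + (?n - 1)"]) (blast, simp)
      ultimately show "degle (jacobi_p * \<sigma> * (pderiv (pderiv N) * N - pderiv N * pderiv N)) (2 + ?s + (?n + ?n - 2))"
        by (intro degle_mult degle_diff p degle_degree)
    qed simp
    have 3: "degle (L * pderiv \<sigma> * (N * N)) (?s + 2 * ?n)"
      by (rule degle_mono[where k = "1 + (?s - 1) + (?n + ?n)"]) (blast, simp)
    have 4: "degle (pderiv \<sigma> * (N * N)) (?s + 2 * ?n - 1)"
      by (rule degle_mono[where k = "(?s - 1) + (?n + ?n)"]) (blast, simp)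
    have 5: "degle (\<sigma> * N * pderiv N) (?s + 2 * ?n - 1)"
      by (rule degle_mono[where k = "?s + ?n + (?n - 1)"]) (blast, simp)
    have 6: "degle (pderiv jacobi_p * (pderiv \<sigma> * (N * N) + \<sigma> * N * pderiv N)) (?s + 2 * ?n)"
      by (rule degle_mono[OF degle_mult[OF p' degle_add[OF 4 5]]]) simp
    have 7: "degle (C * \<sigma> * (N * N)) (int (degree d) + (?s + 2 * ?n))"
      by (rule degle_mono[where k = "int (degree d) + ?s + (?n + ?n)"]) (blast, simp)
    have "degle H (int (degree d) + (?s + 2 * ?n))"
      unfolding H_def
      by (rule degle_diff[OF 7 degle_mult[OF degle_degree degle_add[OF degle_diff[OF
              degle_add[OF 1 degle_add[OF 2 2]] 3] 6]]])
    thus ?thesis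
      using d_nonzero \<sigma>(1) N(1) by (simp add: degree_mult_eq add.assoc)
  qed
  \<comment> \<open>The degree bound for \<open>H\<close> equals the degree of its divisor, so the
    quotient is a constant: the spectral shift.\<close>
  hence "degree K \<le> 0"
    unfolding K using d_nonzero \<sigma>(1) N(1) by (intro degle_quotient[of "d * \<sigma> * (N * N)"]) auto
  then obtain c where c: "K = [:c:]"
    by (metis degree_0_id le_zero_eq degree_eq_zeroE)
  show ?thesis
  proof (rule that[OF at_1 degree_L L_eq])
    show "C * \<sigma> * N\<^sup>2 = d * (jacobi_p * pderiv (pderiv \<sigma>) * N\<^sup>2
        + 2 * (jacobi_p * \<sigma> * (pderiv (pderiv N) * N - (pderiv N)\<^sup>2)) - L * pderiv \<sigma> * N\<^sup>2
        + pderiv jacobi_p * (pderiv \<sigma> * N\<^sup>2 + \<sigma> * N * pderiv N) + smult c (\<sigma> * N\<^sup>2))"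
      (is "?lhs = d * (?rhs + _)")
    proof -
      have "?lhs - d * ?rhs = H"
        unfolding H_def mult_2 power2_eq_square ..
      also have "\<dots> = d * smult c (\<sigma> * N\<^sup>2)"
        unfolding K c power2_eq_square by (simp add: mult.assoc)
      finally show ?thesis
        unfolding distrib_left by (simp only: diff_eq_eq add.commute)
    qed
  qed
qed
end

section \<open>The gauge transformation\<close>

text \<open>The divisor is linear for a real root and otherwise the quadratic with roots
  \<open>\<xi>\<close> and \<open>cnj \<xi>\<close>.\<close>

lemma real_divisor_of_root:
  obtains k :: "real poly" where "degree k > 0" "\<And>f. poly (cpoly f) \<xi> = 0 \<Longrightarrow> k dvd f"
proof (cases "\<xi> \<in> \<real>")
  case True
  then obtain a where a: "\<xi> = of_real a" by (elim Reals_cases)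
  show ?thesis
    by (rule that[of "[:-a, 1:]"]) (auto simp: a poly_eq_0_iff_dvd)
next
  case False
  define k where "k = [:Re \<xi> * Re \<xi> + Im \<xi> * Im \<xi>, -2 * Re \<xi>, 1:]"
  have "cpoly k = [:- \<xi>, 1:] * [:- cnj \<xi>, 1:]"
    by (simp add: k_def complex_eq_iff)
  moreover have "[:- \<xi>, 1:] * [:- cnj \<xi>, 1:] dvd cpoly f" if "poly (cpoly f) \<xi> = 0" for f
  proof -
    from that obtain g where g: "cpoly f = [:- \<xi>, 1:] * g"
      by (auto simp: poly_eq_0_iff_dvd elim!: dvdE)
    have "poly (cpoly f) (cnj \<xi>) = 0"
      using that poly_cnj[of "cpoly f" \<xi>] by simp
    hence "(cnj \<xi> - \<xi>) * poly g (cnj \<xi>) = 0"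
      unfolding g by auto
    moreover have "cnj \<xi> - \<xi> \<noteq> 0"
      using False by (metis Reals_cnj_iff right_minus_eq)
    ultimately have "[:- cnj \<xi>, 1:] dvd g"
      by (simp add: poly_eq_0_iff_dvd)
    thus ?thesis unfolding g by (intro mult_dvd_mono dvd_refl)
  qed
  ultimately show ?thesis
    by (intro that[of k] cpoly_dvd_imp_dvd) (auto simp: k_def)
qed

text \<open>A common divisor of maximal degree exists because \<open>P i0\<close> bounds the
  degrees. A common complex root of the cofactors would supply a further real factor.\<close>

lemma maximal_common_divisor:
  fixes P :: "'i \<Rightarrow> real poly"
  assumes "i0 \<in> A" "P i0 \<noteq> 0"
  obtains M R where "M \<noteq> 0" "\<And>i. i \<in> A \<Longrightarrow> P i = M * R i" "\<And>\<xi>. \<exists>i\<in>A. poly (cpoly (R i)) \<xi> \<noteq> 0"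
proof -
  let ?Q = "\<lambda>M. \<forall>i\<in>A. M dvd P i"
  have "\<exists>M. ?Q M \<and> (\<forall>M'. ?Q M' \<longrightarrow> degree M' \<le> degree M)"
    by (rule ex_has_greatest_nat[where k = 1 and b = "Suc (degree (P i0))"])
       (use assms in \<open>auto intro: dvd_imp_degree_le le_imp_less_Suc\<close>)
  then obtain M where M: "?Q M" "\<And>M'. ?Q M' \<Longrightarrow> degree M' \<le> degree M" by blast
  have "M \<noteq> 0" using M(1) assms by auto
  from M(1) obtain R where R: "\<And>i. i \<in> A \<Longrightarrow> P i = M * R i"
    unfolding dvd_def by metis
  show ?thesis
  proof (rule that[OF \<open>M \<noteq> 0\<close> R])
    fix \<xi>
    show "\<exists>i\<in>A. poly (cpoly (R i)) \<xi> \<noteq> 0"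
    proof (rule ccontr)
      assume *: "\<not> ?thesis"
      obtain k where k: "degree k > 0" "\<And>f. poly (cpoly f) \<xi> = 0 \<Longrightarrow> k dvd f"
        by (rule real_divisor_of_root[of \<xi>]) blast
      have "?Q (M * k)"
        using * R k(2) by (auto intro!: mult_dvd_mono)
      hence "degree (M * k) \<le> degree M" by (rule M(2))
      thus False using k(1) \<open>M \<noteq> 0\<close> by (subst (asm) degree_mult_eq) auto
    qed
  qed
qed

section \<open>Pointwise identities and derivatives of quotients\<close>

lemma poly_eqI_off_zeros:
  fixes f g h :: "real poly"
  assumes "h \<noteq> 0" "\<And>x. poly h x \<noteq> 0 \<Longrightarrow> poly f x = poly g x"
  shows "f = g"
proof -
  have "poly (h * f) x = poly (h * g) x" for x
    using assms(2)[of x] by (cases "poly h x = 0") auto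
  hence "h * f = h * g"
    by (simp add: poly_eq_poly_eq_iff[symmetric] fun_eq_iff)
  thus ?thesis using assms(1) by simp
qed

lemma poly_eqI_interval:
  fixes f g :: "real poly"
  assumes "a < b" "\<And>x. x \<in> {a<..<b} \<Longrightarrow> poly f x = poly g x"
  shows "f = g"
proof (rule ccontr)
  assume "f \<noteq> g"
  hence "finite {x. poly (f - g) x = 0}" by (intro poly_roots_finite) simp
  moreover have "{a<..<b} \<subseteq> {x. poly (f - g) x = 0}" using assms(2) by auto
  ultimately show False
    using assms(1) infinite_Ioo[of a b] finite_subset by blast
qed

lemma deriv_poly: "deriv (poly f) = poly (pderiv f)" for f :: "real poly"
  by (rule ext) (rule DERIV_imp_deriv[OF poly_DERIV])

lemma second_derivative:
  fixes f :: "real \<Rightarrow> real"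
  assumes "open S" "x \<in> S" "\<And>t. t \<in> S \<Longrightarrow> (f has_real_derivative f' t) (at t)"
    and "(f' has_real_derivative D) (at x)"
  shows "(deriv f has_real_derivative D) (at x)"
  by (rule has_field_derivative_transform_within_open[OF assms(4,1,2)])
     (use DERIV_imp_deriv[OF assms(3)] in simp)

lemma DERIV_rational:
  fixes f g :: "real poly"
  assumes "poly g x \<noteq> 0"
  shows "((\<lambda>t. poly f t / poly g t) has_real_derivative
     poly (pderiv f * g - f * pderiv g) x / poly (g * g) x) (at x)"
  using DERIV_divide[OF poly_DERIV[of f x] poly_DERIV[of g x] assms] by simp

lemma twice_diff_on_rational:
  fixes f g :: "real poly"
  assumes "open S" "\<And>x. x \<in> S \<Longrightarrow> poly g x \<noteq> 0"
  shows "twice_diff_on (\<lambda>t. poly f t / poly g t) S"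
  unfolding twice_diff_on_def
proof (intro ballI conjI)
  fix x assume x: "x \<in> S"
  show "(\<lambda>t. poly f t / poly g t) differentiable at x"
    using DERIV_rational[OF assms(2)[OF x]] real_differentiable_def by blast
  have "poly (g * g) x \<noteq> 0" using assms(2)[OF x] by simp
  from second_derivative[OF assms(1) x DERIV_rational[OF assms(2)] DERIV_rational[OF this]]
  show "deriv (\<lambda>t. poly f t / poly g t) differentiable at x"
    using real_differentiable_def by blast
qed

lemma op_apply_cong_open:
  assumes "open S" "x \<in> S" "\<And>t. t \<in> S \<Longrightarrow> f t = g t"
  shows "op_apply T f x = op_apply T g x"
proof -
  have d: "deriv f t = deriv g t" if "t \<in> S" for t
    using assms that by (intro deriv_cong_ev refl) (auto simp: eventually_nhds)
  have "deriv (deriv f) x = deriv (deriv g) x"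
    using assms d by (intro deriv_cong_ev refl) (auto simp: eventually_nhds)
  thus ?thesis
    using assms(3)[OF assms(2)] d[OF assms(2)] by (simp add: op_apply_def)
qed

text \<open>With \<open>\<kappa> = M / N\<close>, the logarithmic derivative of
  \<open>\<kappa>\<close> is \<open>m - n\<close>, and its second derivative divided by
  \<open>\<kappa>\<close> is \<open>h - f - 2 * m * n + 2 * n^2\<close>.\<close>

lemma op_apply_product:
  fixes y :: "real \<Rightarrow> real" and M N :: "real poly"
  assumes S: "open S" "x \<in> S" and y: "twice_diff_on y S" and N: "\<forall>t\<in>S. poly N t \<noteq> 0"
    and M: "poly M x \<noteq> 0"
  defines "m \<equiv> poly (pderiv M) x / poly M x" and "h \<equiv> poly (pderiv (pderiv M)) x / poly M x"
    and "n \<equiv> poly (pderiv N) x / poly N x" and "f \<equiv> poly (pderiv (pderiv N)) x / poly N x"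
  shows "poly N x / poly M x * op_apply (p, q, r) (\<lambda>t. y t / (poly N t / poly M t)) x
    = reval p x * (deriv (deriv y) x + 2 * (m - n) * deriv y x + (h - f - 2 * m * n + 2 * n\<^sup>2) * y x)
      + reval q x * (deriv y x + (m - n) * y x) + reval r x * y x"
proof -
  define \<kappa> where "\<kappa> = (\<lambda>t. poly M t / poly N t)"
  define \<kappa>1 where "\<kappa>1 = (\<lambda>t. poly (pderiv M * N - M * pderiv N) t / poly (N * N) t)"
  define \<kappa>2 where "\<kappa>2 = poly (pderiv (pderiv M * N - M * pderiv N) * (N * N)
      - (pderiv M * N - M * pderiv N) * pderiv (N * N)) x / poly (N * N * (N * N)) x"
  have \<kappa>: "(\<kappa> has_real_derivative \<kappa>1 t) (at t)" if "t \<in> S" for t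
    unfolding \<kappa>_def \<kappa>1_def using N that by (intro DERIV_rational) simp
  have \<kappa>1: "(\<kappa>1 has_real_derivative \<kappa>2) (at x)"
    unfolding \<kappa>1_def \<kappa>2_def using N S(2) by (intro DERIV_rational) simp
  have y1: "(y has_real_derivative deriv y t) (at t)" if "t \<in> S" for t
    using y that by (simp add: twice_diff_on_def DERIV_deriv_iff_real_differentiable)
  have y2: "(deriv y has_real_derivative deriv (deriv y) x) (at x)"
    using y S(2) by (simp add: twice_diff_on_def DERIV_deriv_iff_real_differentiable)
  define z where "z = (\<lambda>t. y t * \<kappa> t)"
  have z: "(\<lambda>t. y t / (poly N t / poly M t)) = z"
    by (simp add: z_def \<kappa>_def)
  have z1: "(z has_real_derivative deriv y t * \<kappa> t + \<kappa>1 t * y t) (at t)" if "t \<in> S" for t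
    unfolding z_def by (rule DERIV_mult[OF y1[OF that] \<kappa>[OF that]])
  have z2: "((\<lambda>t. deriv y t * \<kappa> t + \<kappa>1 t * y t) has_real_derivative
      (deriv (deriv y) x * \<kappa> x + \<kappa>1 x * deriv y x) + (\<kappa>2 * y x + deriv y x * \<kappa>1 x)) (at x)"
    by (intro DERIV_add DERIV_mult y2 \<kappa> \<kappa>1 y1 S(2))
  have dz: "deriv z x = deriv y x * \<kappa> x + \<kappa>1 x * y x"
    by (rule DERIV_imp_deriv[OF z1[OF S(2)]])
  have ddz: "deriv (deriv z) x = (deriv (deriv y) x * \<kappa> x + \<kappa>1 x * deriv y x) + (\<kappa>2 * y x + deriv y x * \<kappa>1 x)"
    by (rule DERIV_imp_deriv[OF second_derivative[OF S z1 z2]])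
  have nz: "poly N x \<noteq> 0" "\<kappa> x \<noteq> 0" using N S(2) M by (auto simp: \<kappa>_def)
  have k: "poly N x / poly M x = 1 / \<kappa> x" by (simp add: \<kappa>_def)
  have k1: "\<kappa>1 x = (m - n) * \<kappa> x"
    using nz M by (simp add: \<kappa>1_def m_def n_def \<kappa>_def field_simps)
  have k2: "\<kappa>2 = (h - f - 2 * m * n + 2 * n\<^sup>2) * \<kappa> x"
    using nz M by (simp add: \<kappa>2_def m_def n_def h_def f_def \<kappa>_def field_simps pderiv_mult pderiv_diff power2_eq_square)
  have zx: "z x = y x * \<kappa> x" by (simp add: z_def)
  show ?thesis
    unfolding z k op_apply_def prod.case dz ddz zx k1 k2 using nz(2)
    by (simp add: field_simps)
qed

text \<open>The parameters are the solution of \<open>(x^2 - 1) * eta = L\<close>, read off at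
  \<open>x = 1\<close> and \<open>x = -1\<close>; this clears the apparent poles there.\<close>

lemma Tng_eq:
  assumes "poly (\<sigma> * N) x \<noteq> 0" "x \<noteq> 1" "x \<noteq> -1" and L: "degree L \<le> 1"
  defines "s \<equiv> poly (pderiv \<sigma>) x / poly \<sigma> x" and "e \<equiv> poly (pderiv (pderiv \<sigma>)) x / poly \<sigma> x"
    and "n \<equiv> poly (pderiv N) x / poly N x" and "f \<equiv> poly (pderiv (pderiv N)) x / poly N x"
  shows "Tng (\<sigma> * N) (poly L 1 / 2 - 1) (- poly L (-1) / 2 - 1) y x
    = (x\<^sup>2 - 1) * (deriv (deriv y) x - 2 * (s + n) * deriv y x + (e + 2 * s * n + f) * y x)
      + poly L x * (deriv y x - (s + n) * y x) + 2 * x * (s + n) * y x"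
proof -
  have "L = [:coeff L 0, coeff L 1:]"
    by (rule poly_eqI) (use L in \<open>auto simp: coeff_pCons coeff_eq_0 split: nat.splits\<close>)
  then obtain l0 l1 where l: "L = [:l0, l1:]" by blast
  have nz: "poly \<sigma> x \<noteq> 0" "poly N x \<noteq> 0" using assms(1) by auto
  have 1: "poly (pderiv (\<sigma> * N)) x / poly (\<sigma> * N) x = s + n"
    using nz by (simp add: s_def n_def pderiv_mult field_simps)
  have 2: "poly (pderiv (pderiv (\<sigma> * N))) x / poly (\<sigma> * N) x = e + 2 * s * n + f"
    using nz by (simp add: s_def n_def e_def f_def pderiv_mult pderiv_add field_simps)
  have *: "(x - 1) * (x + 1) * (A / (x - 1) + A' / (x + 1)) = A * (x + 1) + A' * (x - 1)" for A A' :: real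
  proof -
    have "u * v * (A / u + A' / v) = A * v + A' * u" if "u \<noteq> 0" "v \<noteq> 0" for u v :: real
      using that by (simp add: field_simps)
    from this[of "x - 1" "x + 1"] show ?thesis
      using assms(2,3) by (simp add: add_eq_0_iff)
  qed
  have "x\<^sup>2 - 1 = (x - 1) * (x + 1)" by (simp add: power2_eq_square algebra_simps)
  hence 3: "(x\<^sup>2 - 1) * eta (poly L 1 / 2 - 1) (- poly L (-1) / 2 - 1) x = poly L x"
    unfolding eta_def by (simp only: *) (simp add: l field_simps)
  show ?thesis
    unfolding Tng_def 1 2 distrib_left[of "x\<^sup>2 - 1"] mult.assoc[of "x\<^sup>2 - 1" "eta _ _ _", symmetric] 3
    by (simp add: algebra_simps)
qed

text \<open>The hypotheses \<open>B\<close> and \<open>C\<close> are the natural form of the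
  operator conjugated by \<open>M\<close>. Evaluating them at \<open>x\<close> and cancelling
  nonzero values recovers \<open>q\<close> and \<open>r\<close> of the original operator.\<close>

lemma gauge_identity:
  fixes d0 B0 C0 M N \<sigma> L :: "real poly" and x c :: real
  assumes nz: "poly d0 x \<noteq> 0" "poly M x \<noteq> 0" "poly \<sigma> x \<noteq> 0" "poly N x \<noteq> 0"
  defines "s \<equiv> poly (pderiv \<sigma>) x / poly \<sigma> x" and "e \<equiv> poly (pderiv (pderiv \<sigma>)) x / poly \<sigma> x"
    and "n \<equiv> poly (pderiv N) x / poly N x" and "f \<equiv> poly (pderiv (pderiv N)) x / poly N x"
    and "m \<equiv> poly (pderiv M) x / poly M x" and "h \<equiv> poly (pderiv (pderiv M)) x / poly M x"
  assumes B: "(2 * (jacobi_p * d0 * pderiv M) + B0 * M) * \<sigma> = d0 * M * (L * \<sigma> - 2 * (jacobi_p * pderiv \<sigma>))"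
    and C: "(jacobi_p * d0 * pderiv (pderiv M) + B0 * pderiv M + C0 * M) * \<sigma> * N\<^sup>2
      = d0 * M * (jacobi_p * pderiv (pderiv \<sigma>) * N\<^sup>2
        + 2 * (jacobi_p * \<sigma> * (pderiv (pderiv N) * N - (pderiv N)\<^sup>2)) - L * pderiv \<sigma> * N\<^sup>2
        + pderiv jacobi_p * (pderiv \<sigma> * N\<^sup>2 + \<sigma> * N * pderiv N) + smult c (\<sigma> * N\<^sup>2))"
  shows "poly B0 x / poly d0 x = poly L x - 2 * (x\<^sup>2 - 1) * (s + m)"
    and "poly C0 x / poly d0 x = (x\<^sup>2 - 1) * (e + 2 * (f - n\<^sup>2) - h) - poly L x * s + 2 * x * (s + n) + c
      - (poly L x - 2 * (x\<^sup>2 - 1) * (s + m)) * m"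
proof -
  define J where "J = x\<^sup>2 - 1"
  have J: "poly jacobi_p x = J" "poly (pderiv jacobi_p) x = 2 * x"
    by (simp_all add: J_def power2_eq_square pderiv_pCons)
  define \<sigma>0 N0 M0 D where "\<sigma>0 = poly \<sigma> x" and "N0 = poly N x" and "M0 = poly M x" and "D = poly d0 x"
  have v: "poly (pderiv \<sigma>) x = s * \<sigma>0" "poly (pderiv (pderiv \<sigma>)) x = e * \<sigma>0"
    "poly (pderiv N) x = n * N0" "poly (pderiv (pderiv N)) x = f * N0"
    "poly (pderiv M) x = m * M0" "poly (pderiv (pderiv M)) x = h * M0"
    using nz by (simp_all add: s_def e_def n_def f_def m_def h_def \<sigma>0_def N0_def M0_def)
  define b where "b = poly B0 x / poly d0 x"
  define c0 where "c0 = poly C0 x / poly d0 x"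
  have bc: "poly B0 x = b * D" "poly C0 x = c0 * D"
    using nz by (simp_all add: b_def c0_def D_def)
  note w = v bc J \<sigma>0_def[symmetric] N0_def[symmetric] M0_def[symmetric] D_def[symmetric]
  have nz': "D \<noteq> 0" "M0 \<noteq> 0" "\<sigma>0 \<noteq> 0" "N0 \<noteq> 0"
    using nz by (simp_all add: w)
  have "D * M0 * \<sigma>0 * (2 * J * m + b) = D * M0 * \<sigma>0 * (poly L x - 2 * J * s)"
    using arg_cong[OF B, of "\<lambda>f. poly f x"]
    by (simp only: poly_add poly_diff poly_mult poly_smult poly_power poly_numeral w) (simp add: algebra_simps)
  hence "2 * J * m + b = poly L x - 2 * J * s"
    using nz' by simp
  hence b: "b = poly L x - 2 * J * (s + m)"
    by (simp add: algebra_simps)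
  have "D * M0 * \<sigma>0 * N0\<^sup>2 * (J * h + b * m + c0)
      = D * M0 * \<sigma>0 * N0\<^sup>2 * (J * e + 2 * J * (f - n\<^sup>2) - poly L x * s + 2 * x * (s + n) + c)"
    using arg_cong[OF C, of "\<lambda>f. poly f x"]
    by (simp only: poly_add poly_diff poly_mult poly_smult poly_power poly_numeral w)
       (simp add: algebra_simps power2_eq_square)
  hence "J * h + b * m + c0 = J * e + 2 * J * (f - n\<^sup>2) - poly L x * s + 2 * x * (s + n) + c"
    using nz' by simp
  hence c0: "c0 = J * (e + 2 * (f - n\<^sup>2) - h) - poly L x * s + 2 * x * (s + n) + c - b * m"
    by (simp add: algebra_simps)
  show "poly B0 x / poly d0 x = poly L x - 2 * (x\<^sup>2 - 1) * (s + m)"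
    using b unfolding b_def J_def .
  show "poly C0 x / poly d0 x = (x\<^sup>2 - 1) * (e + 2 * (f - n\<^sup>2) - h) - poly L x * s + 2 * x * (s + n) + c
      - (poly L x - 2 * (x\<^sup>2 - 1) * (s + m)) * m"
    using c0[unfolded b] unfolding c0_def J_def .
qed

text \<open>Multiplication by \<open>snd q * snd r\<close> turns the pointwise equation, valid off
  finitely many zeros, into a polynomial identity. The pointwise form is kept for the later
  computation with \<open>op_apply\<close>.\<close>

lemma exceptional_jacobi_polynomial_form:
  assumes "exceptional_jacobi (p, q, r)"
  obtains F P lam where "finite F" "\<And>n. n \<notin> F \<Longrightarrow> P n \<noteq> 0 \<and> degree (P n) = n"
    "\<And>n. n \<notin> F \<Longrightarrow> jacobi_p * (snd q * snd r) * pderiv (pderiv (P n)) + fst q * snd r * pderiv (P n)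
        + fst r * snd q * P n = smult (lam n) (snd q * snd r * P n)"
    "\<And>n x. n \<notin> F \<Longrightarrow> op_defined_at (p, q, r) x \<Longrightarrow>
        op_apply (p, q, r) (poly (P n)) x = lam n * poly (P n) x"
proof -
  have nz: "snd p \<noteq> 0" "snd q \<noteq> 0" "snd r \<noteq> 0"
    using assms by (auto simp: exceptional_jacobi_def exceptional_def op_ok_def ratfun_ok_def)
  have p: "reval p x = x\<^sup>2 - 1" if "poly (snd p) x \<noteq> 0" for x
    using assms that by (simp add: exceptional_jacobi_def)
  obtain F where F: "finite F" "\<And>n. n \<notin> F \<Longrightarrow> \<exists>P lam. P \<noteq> 0 \<and> degree P = n \<and>
      (\<forall>x. op_defined_at (p, q, r) x \<longrightarrow> op_apply (p, q, r) (poly P) x = lam * poly P x)"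
    using assms unfolding exceptional_jacobi_def exceptional_def by blast
  then obtain P lam where P: "\<And>n. n \<notin> F \<Longrightarrow> P n \<noteq> 0 \<and> degree (P n) = n \<and>
      (\<forall>x. op_defined_at (p, q, r) x \<longrightarrow> op_apply (p, q, r) (poly (P n)) x = lam n * poly (P n) x)"
    by metis
  show ?thesis
  proof (rule that[OF F(1)])
    fix n assume n: "n \<notin> F"
    show "jacobi_p * (snd q * snd r) * pderiv (pderiv (P n)) + fst q * snd r * pderiv (P n)
        + fst r * snd q * P n = smult (lam n) (snd q * snd r * P n)"
    proof (rule poly_eqI_off_zeros)
      show "snd p * snd q * snd r \<noteq> 0" using nz by simp
      fix x assume "poly (snd p * snd q * snd r) x \<noteq> 0"
      hence x: "poly (snd p) x \<noteq> 0" "poly (snd q) x \<noteq> 0" "poly (snd r) x \<noteq> 0" by auto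
      hence "op_apply (p, q, r) (poly (P n)) x = lam n * poly (P n) x"
        using P[OF n] by (simp add: op_defined_at_def)
      hence T: "(x\<^sup>2 - 1) * poly (pderiv (pderiv (P n))) x
          + reval q x * poly (pderiv (P n)) x + reval r x * poly (P n) x = lam n * poly (P n) x"
        by (simp add: op_apply_def deriv_poly p[OF x(1)])
      have "poly (fst q) x = reval q x * poly (snd q) x" "poly (fst r) x = reval r x * poly (snd r) x"
        using x by (simp_all add: reval_def)
      hence "poly (jacobi_p * (snd q * snd r) * pderiv (pderiv (P n)) + fst q * snd r * pderiv (P n)
          + fst r * snd q * P n) x = poly (snd q) x * poly (snd r) x * ((x\<^sup>2 - 1) * poly (pderiv (pderiv (P n))) x
          + reval q x * poly (pderiv (P n)) x + reval r x * poly (P n) x)"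
        by (simp add: algebra_simps power2_eq_square)
      thus "poly (jacobi_p * (snd q * snd r) * pderiv (pderiv (P n)) + fst q * snd r * pderiv (P n)
          + fst r * snd q * P n) x = poly (smult (lam n) (snd q * snd r * P n)) x"
        unfolding T by simp
    qed
  qed (use P in auto)
qed

lemma interval_without_roots:
  fixes f :: "real poly"
  assumes "f \<noteq> 0"
  obtains a where "\<And>x. x > a \<Longrightarrow> poly f x \<noteq> 0"
proof -
  have "finite {x. poly f x = 0}" by (rule poly_roots_finite[OF assms])
  hence "bdd_above {x. poly f x = 0}" by (rule bdd_above_finite)
  then obtain a where "\<And>x. poly f x = 0 \<Longrightarrow> x \<le> a" unfolding bdd_above_def by blast
  thus ?thesis by (intro that[of a]) force
qed

theorem mainTheorem1:
  fixes T :: ratop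
  assumes "exceptional_jacobi T"
  shows "\<exists>(\<tau> :: real poly) (\<alpha> :: real) (\<beta> :: real) (c :: real) (\<mu> :: real \<Rightarrow> real) (a :: real) (b :: real).
           poly \<tau> 1 \<noteq> 0 \<and> poly \<tau> (-1) \<noteq> 0 \<and> a < b \<and>
           (\<forall>x\<in>{a<..<b}. op_defined_at T x \<and> poly \<tau> x \<noteq> 0 \<and> x \<noteq> 1 \<and> x \<noteq> -1 \<and> \<mu> x \<noteq> 0) \<and>
           twice_diff_on \<mu> {a<..<b} \<and>
           (\<forall>y. twice_diff_on y {a<..<b} \<longrightarrow> (\<forall>x\<in>{a<..<b}.
              \<mu> x * op_apply T (\<lambda>t. y t / \<mu> t) x + c * y x = Tng \<tau> \<alpha> \<beta> y x)) \<and>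
           (\<exists>S :: ratop. exceptional_jacobi S \<and>
              (\<forall>y x. op_defined_at S x \<and> poly \<tau> x \<noteq> 0 \<and> x \<noteq> 1 \<and> x \<noteq> -1 \<longrightarrow>
                 op_apply S y x = Tng \<tau> \<alpha> \<beta> y x))"
proof -
  obtain p q r where T: "T = (p, q, r)" by (cases T)
  note exc = assms[unfolded T]
  define d0 B0 C0 where "d0 = snd q * snd r" and "B0 = fst q * snd r" and "C0 = fst r * snd q"
  have snd_nz: "snd p \<noteq> 0" "snd q \<noteq> 0" "snd r \<noteq> 0"
    using exc by (auto simp: exceptional_jacobi_def exceptional_def op_ok_def ratfun_ok_def)
  obtain F P lam where F: "finite F" and P: "\<And>n. n \<notin> F \<Longrightarrow> P n \<noteq> 0 \<and> degree (P n) = n"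
    and eig: "\<And>n. n \<notin> F \<Longrightarrow> jacobi_p * d0 * pderiv (pderiv (P n)) + B0 * pderiv (P n) + C0 * P n
        = smult (lam n) (d0 * P n)"
    and eig': "\<And>n x. n \<notin> F \<Longrightarrow> op_defined_at T x \<Longrightarrow> op_apply T (poly (P n)) x = lam n * poly (P n) x"
    unfolding T d0_def B0_def C0_def by (rule exceptional_jacobi_polynomial_form[OF exc]) blast
  have "infinite (- F)" using F by (simp add: Compl_eq_Diff_UNIV)
  then obtain n0 where n0: "n0 \<in> - F" by (metis ex_in_conv finite.emptyI)
  obtain M R where M: "M \<noteq> 0" and R: "\<And>n. n \<in> - F \<Longrightarrow> P n = M * R n"
    and no_root: "\<And>\<xi>. \<exists>n\<in>- F. poly (cpoly (R n)) \<xi> \<noteq> 0"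
    by (rule maximal_common_divisor[OF n0, of P]) (use P n0 in blast)+
  define k where "k = degree M"
  have R_nz: "R n \<noteq> 0" and deg_R: "degree (R n) + k = n" if "n \<notin> F" for n
  proof -
    show "R n \<noteq> 0" using P[OF that] R[of n] that by auto
    thus "degree (R n) + k = n"
      using P[OF that] R[of n] that M by (auto simp: k_def degree_mult_eq)
  qed
  \<comment> \<open>Division by \<open>M\<close> lowers every eigenpolynomial degree by
    \<open>k\<close>.\<close>
  define F' where "F' = {n. n + k \<in> F}"
  have F': "finite F'"
    unfolding F'_def using finite_vimageI[OF F, of "\<lambda>n. n + k"] by (simp add: vimage_def inj_def)
  \<comment> \<open>\<open>B\<close> and \<open>C\<close> are the numerators over
    \<open>d0 * M\<close> of the lower coefficients of \<open>T\<close> conjugated by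
    \<open>M\<close>.\<close>
  define B where "B = 2 * (jacobi_p * d0 * pderiv M) + B0 * M"
  define C where "C = jacobi_p * d0 * pderiv (pderiv M) + B0 * pderiv M + C0 * M"
  interpret red: reduced_operator "d0 * M" B C F' "\<lambda>n. R (n + k)" "\<lambda>n. lam (n + k)"
  proof
    show "d0 * M \<noteq> 0" using snd_nz M by (simp add: d0_def)
    show "finite F'" by (rule F')
    show "R (n + k) \<noteq> 0" if "n \<notin> F'" for n using R_nz that by (simp add: F'_def)
    show "degree (R (n + k)) = n" if "n \<notin> F'" for n using deg_R[of "n + k"] that by (simp add: F'_def)
    show "jacobi_p * (d0 * M) * pderiv (pderiv (R (n + k))) + B * pderiv (R (n + k)) + C * R (n + k)
        = smult (lam (n + k)) (d0 * M * R (n + k))" if "n \<notin> F'" for n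
    proof -
      have n: "n + k \<notin> F" using that by (simp add: F'_def)
      show ?thesis
        using eig[OF n] R[of "n + k"] n unfolding B_def C_def
        by (simp add: pderiv_mult pderiv_add algebra_simps del: mult_pCons_left mult_pCons_right)
    qed
    show "\<exists>n. n \<notin> F' \<and> poly (cpoly (R (n + k))) \<xi> \<noteq> 0" for \<xi>
    proof -
      obtain n where n: "n \<notin> F" "poly (cpoly (R n)) \<xi> \<noteq> 0" using no_root by auto
      hence "n = (n - k) + k" using deg_R[OF n(1)] by simp
      with n show ?thesis unfolding F'_def by (metis mem_Collect_eq)
    qed
  qed
  obtain \<sigma> N L c where at1: "poly \<sigma> 1 \<noteq> 0" "poly \<sigma> (-1) \<noteq> 0" "poly N 1 \<noteq> 0" "poly N (-1) \<noteq> 0"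
    and L: "degree L \<le> 1"
    and BL: "B * \<sigma> = d0 * M * (L * \<sigma> - 2 * (jacobi_p * pderiv \<sigma>))"
    and CL: "C * \<sigma> * N\<^sup>2 = d0 * M * (jacobi_p * pderiv (pderiv \<sigma>) * N\<^sup>2
        + 2 * (jacobi_p * \<sigma> * (pderiv (pderiv N) * N - (pderiv N)\<^sup>2)) - L * pderiv \<sigma> * N\<^sup>2
        + pderiv jacobi_p * (pderiv \<sigma> * N\<^sup>2 + \<sigma> * N * pderiv N) + smult c (\<sigma> * N\<^sup>2))"
    by (rule red.natural_form)
  define \<tau> where "\<tau> = \<sigma> * N"
  define \<alpha> where "\<alpha> = poly L 1 / 2 - 1"
  define \<beta> where "\<beta> = - poly L (-1) / 2 - 1"
  define \<mu> where "\<mu> = (\<lambda>x. poly N x / poly M x)"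
  have nz: "\<sigma> \<noteq> 0" "N \<noteq> 0" "\<tau> \<noteq> 0" using at1 by (auto simp: \<tau>_def)
  \<comment> \<open>To the right of all zeros of this product, every denominator in sight and the
    gauge factor are nonzero; \<open>jacobi_p\<close> excludes the points \<open>1\<close> and
    \<open>-1\<close>.\<close>
  have "\<tau> * M * (snd p * snd q * snd r) * jacobi_p \<noteq> 0"
    using nz M snd_nz by (simp del: mult_pCons_right)
  then obtain a where a: "\<And>x. x > a \<Longrightarrow> poly (\<tau> * M * (snd p * snd q * snd r) * jacobi_p) x \<noteq> 0"
    using interval_without_roots by blast
  define I where "I = {a<..<a + 1}"
  have I: "poly \<sigma> x \<noteq> 0" "poly N x \<noteq> 0" "poly M x \<noteq> 0" "poly (snd p) x \<noteq> 0" "poly (snd q) x \<noteq> 0"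
    "poly (snd r) x \<noteq> 0" "x \<noteq> 1" "x \<noteq> -1" if "x \<in> I" for x
    using a[of x] that by (auto simp: I_def \<tau>_def)
  have "open I" by (simp add: I_def)
  have defined: "op_defined_at T x" if "x \<in> I" for x
    using I[OF that] by (simp add: T op_defined_at_def)

  have gauge: "\<mu> x * op_apply T (\<lambda>t. y t / \<mu> t) x + (- c) * y x = Tng \<tau> \<alpha> \<beta> y x"
    if y: "twice_diff_on y I" and x: "x \<in> I" for y x
  proof -
    have 1: "reval p x = x\<^sup>2 - 1" using exc I[OF x] by (simp add: exceptional_jacobi_def)
    have d0: "poly d0 x \<noteq> 0" using I[OF x] by (simp add: d0_def)
    have 2: "reval q x = poly B0 x / poly d0 x" "reval r x = poly C0 x / poly d0 x"
      using I[OF x] by (simp_all add: reval_def B0_def C0_def d0_def)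
    note G = gauge_identity[OF d0 I(3)[OF x] I(1)[OF x] I(2)[OF x] BL[unfolded B_def] CL[unfolded C_def]]
    have "poly (\<sigma> * N) x \<noteq> 0" using I[OF x] by simp
    note Tn = Tng_eq[OF this I(7)[OF x] I(8)[OF x] L, of y, folded \<tau>_def \<alpha>_def \<beta>_def]
    have "\<forall>t\<in>I. poly N t \<noteq> 0" using I(2) by blast
    note O = op_apply_product[OF \<open>open I\<close> x y this I(3)[OF x], of p q r, folded T]
    have ring: "J * (y2 + 2 * (m - n) * y1 + (h - f - 2 * m * n + 2 * n\<^sup>2) * y0)
        + (l - 2 * J * (s + m)) * (y1 + (m - n) * y0)
        + (J * (e + 2 * (f - n\<^sup>2) - h) - l * s + 2 * x * (s + n) + c - (l - 2 * J * (s + m)) * m) * y0 + - c * y0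
      = J * (y2 - 2 * (s + n) * y1 + (e + 2 * s * n + f) * y0) + l * (y1 - (s + n) * y0) + 2 * x * (s + n) * y0"
      for J y0 y1 y2 s e n f m h l :: real
      by (simp add: algebra_simps power2_eq_square)
    show ?thesis
      unfolding \<mu>_def O Tn 1 2 G by (rule ring)
  qed

  \<comment> \<open>The natural form with \<open>L\<close> in place of
    \<open>(x^2 - 1) * eta\<close>, so that its coefficients are undefined only at the zeros of
    \<open>\<tau>\<close>.\<close>
  define S :: ratop where "S = ((jacobi_p, 1), (L * \<tau> - 2 * (jacobi_p * pderiv \<tau>), \<tau>),
      (jacobi_p * pderiv (pderiv \<tau>) - L * pderiv \<tau> + pderiv jacobi_p * pderiv \<tau>, \<tau>))"
  have S_defined: "op_defined_at S x \<longleftrightarrow> poly \<tau> x \<noteq> 0" for x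
    by (simp add: S_def op_defined_at_def)
  have S_Tng: "op_apply S y x = Tng \<tau> \<alpha> \<beta> y x" if "poly \<tau> x \<noteq> 0" "x \<noteq> 1" "x \<noteq> -1" for y x
  proof -
    have "poly \<sigma> x \<noteq> 0" "poly N x \<noteq> 0" using that by (auto simp: \<tau>_def)
    thus ?thesis
      unfolding \<alpha>_def \<beta>_def \<tau>_def Tng_eq[OF that(1)[unfolded \<tau>_def] that(2,3) L]
      by (simp add: S_def op_apply_def reval_def \<tau>_def pderiv_mult pderiv_add pderiv_pCons field_simps power2_eq_square)
  qed
  have "exceptional S"
    unfolding exceptional_def
  \<comment> \<open>The eigenpolynomials of \<open>S\<close> are the products
    \<open>N * R n\<close>, so the exceptional degrees are those of the reduced operator moved up by
    \<open>degree N\<close>, together with all degrees below \<open>degree N\<close>.\<close>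
  proof (intro conjI exI[of _ "{m. m < degree N \<or> m - degree N \<in> F'}"] allI impI)
    show "op_ok S" using nz by (simp add: S_def op_ok_def ratfun_ok_def)
    have "{m. m < degree N \<or> m - degree N \<in> F'} \<subseteq> {..<degree N} \<union> (\<lambda>m. m + degree N) ` F'"
    proof
      fix m assume m: "m \<in> {m. m < degree N \<or> m - degree N \<in> F'}"
      show "m \<in> {..<degree N} \<union> (\<lambda>m. m + degree N) ` F'"
      proof (cases "m < degree N")
        case False
        hence "m = (m - degree N) + degree N" "m - degree N \<in> F'" using m by auto
        thus ?thesis by blast
      qed simp
    qed
    thus "finite {m. m < degree N \<or> m - degree N \<in> F'}"
      by (rule finite_subset) (use F' in simp)
    fix m assume "m \<notin> {m. m < degree N \<or> m - degree N \<in> F'}"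
    hence m: "degree N \<le> m" "m - degree N \<notin> F'" by auto
    define n where "n = m - degree N + k"
    have n: "n \<notin> F" using m by (simp add: n_def F'_def)
    define Q where "Q = N * R n"
    have "degree (R n) = m - degree N" using deg_R[OF n] by (simp add: n_def)
    hence Q: "Q \<noteq> 0" "degree Q = m"
      using nz R_nz[OF n] m by (simp_all add: Q_def degree_mult_eq)
    \<comment> \<open>Dividing \<open>Q\<close> by the gauge factor gives back \<open>P n\<close> on
      the interval; the spectral shift changes its eigenvalue to \<open>lam n - c\<close>.\<close>
    have Q_at_I: "op_apply S (poly Q) x = (lam n - c) * poly Q x" if x: "x \<in> I" for x
    proof -
      have "poly \<tau> x \<noteq> 0" using I[OF x] by (simp add: \<tau>_def)
      hence "op_apply S (poly Q) x = Tng \<tau> \<alpha> \<beta> (poly Q) x"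
        using I[OF x] by (intro S_Tng)
      also have "\<dots> = \<mu> x * op_apply T (\<lambda>t. poly Q t / \<mu> t) x + (- c) * poly Q x"
        using twice_diff_on_rational[OF \<open>open I\<close>, of 1 Q] x by (intro gauge[symmetric]) simp_all
      also have "op_apply T (\<lambda>t. poly Q t / \<mu> t) x = op_apply T (poly (P n)) x"
        using I R[of n] n by (intro op_apply_cong_open[OF \<open>open I\<close> x]) (simp add: \<mu>_def Q_def)
      also have "\<dots> = lam n * poly (P n) x"
        by (rule eig'[OF n defined[OF x]])
      also have "\<mu> x * (lam n * poly (P n) x) = lam n * poly Q x"
        using I[OF x] R[of n] n by (simp add: \<mu>_def Q_def)
      finally show ?thesis by (simp add: algebra_simps)
    qed
    \<comment> \<open>Clearing the denominator \<open>\<tau>\<close> makes the eigenvalue equation a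
      polynomial identity, which extends from the interval to every point where \<open>S\<close> is
      defined.\<close>
    define Z where "Z = jacobi_p * \<tau> * pderiv (pderiv Q) + (L * \<tau> - 2 * (jacobi_p * pderiv \<tau>)) * pderiv Q
      + (jacobi_p * pderiv (pderiv \<tau>) - L * pderiv \<tau> + pderiv jacobi_p * pderiv \<tau>) * Q"
    have Z: "poly Z x = poly \<tau> x * op_apply S (poly Q) x" if "poly \<tau> x \<noteq> 0" for x
      using that by (simp add: Z_def S_def op_apply_def reval_def deriv_poly field_simps)
    have "Z = smult (lam n - c) (\<tau> * Q)"
    proof (rule poly_eqI_interval[of a "a + 1"])
      fix x assume "x \<in> {a<..<a + 1}"
      hence x: "x \<in> I" by (simp add: I_def)
      have "poly \<tau> x \<noteq> 0" using I[OF x] by (simp add: \<tau>_def)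
      thus "poly Z x = poly (smult (lam n - c) (\<tau> * Q)) x"
        using Z Q_at_I[OF x] by simp
    qed simp
    hence "op_apply S (poly Q) x = (lam n - c) * poly Q x" if "op_defined_at S x" for x
      using Z[of x] that by (simp add: S_defined)
    with Q show "\<exists>P lam. P \<noteq> 0 \<and> degree P = m \<and>
        (\<forall>x. op_defined_at S x \<longrightarrow> op_apply S (poly P) x = lam * poly P x)"
      by blast
  qed
  hence S: "exceptional_jacobi S"
    by (simp add: exceptional_jacobi_def S_def reval_def power2_eq_square)
  show ?thesis
  proof (rule exI[of _ \<tau>], rule exI[of _ \<alpha>], rule exI[of _ \<beta>], rule exI[of _ "- c"],
      rule exI[of _ \<mu>], rule exI[of _ a], rule exI[of _ "a + 1"], intro conjI exI[of _ S], fold I_def)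
    show "poly \<tau> 1 \<noteq> 0" using at1 by (simp add: \<tau>_def)
    show "poly \<tau> (-1) \<noteq> 0" using at1 by (simp add: \<tau>_def)
    show "\<forall>x\<in>I. op_defined_at T x \<and> poly \<tau> x \<noteq> 0 \<and> x \<noteq> 1 \<and> x \<noteq> -1 \<and> \<mu> x \<noteq> 0"
      using I defined by (simp add: \<tau>_def \<mu>_def)
    show "twice_diff_on \<mu> I"
      unfolding \<mu>_def using I(3) by (intro twice_diff_on_rational \<open>open I\<close>)
    show "\<forall>y. twice_diff_on y I \<longrightarrow> (\<forall>x\<in>I. \<mu> x * op_apply T (\<lambda>t. y t / \<mu> t) x + - c * y x = Tng \<tau> \<alpha> \<beta> y x)"
      using gauge by blast
    show "\<forall>y x. op_defined_at S x \<and> poly \<tau> x \<noteq> 0 \<and> x \<noteq> 1 \<and> x \<noteq> -1 \<longrightarrow> op_apply S y x = Tng \<tau> \<alpha> \<beta> y x"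
      using S_Tng by blast
  qed (simp_all add: S)
qed

end
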